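(* Let $A$ be a multiring. (i) If $A$ is a real reduced multiring, then $V(A)$ is also a real reduced multiring. (ii) If $A$ is a semi-real von Neumann hyperring, then $Q(A)$ is also a von Neumann hyperring.
   Context: A multiring is a tuple $(A,+,-,\cdot,0,1)$ where $(A,\cdot,1)$ is a commutative monoid, $+\colon A\times A\to\{\text{nonempty subsets of }A\}$ and $-\colon A\to A$ are functions and $0\in A$, such that for all $a,b,c,d\in A$: (1) $a\in b+c$ implies $c\in -b+a$ and $b\in a+(-c)$; (2) $a\in b+0$ iff $a=b$; (3) if $x\in g+c$ with $g\in a+b$, then there is $h\in b+c$ with $x\in a+h$; (4) $a+b=b+a$; (5) $a\cdot 0=0$; (6) $a\in b+c$ implies $ad\in bd+cd$. Sums of subsets are unions of elementwise sums. A hyperring is a multiring such that $x\in bd+cd$ implies $x=ad$ for some $a\in b+c$. A morphism of multirings $f$ satisfies $f(a)\in f(b)+f(c)$ whenever $a\in b+c$, and preserves $\cdot,-,0,1$. A von Neumann hyperring is a hyperring $A$ such that for all $a\in A$ there is $b\in A$ with $a=a^2b$. $\sum A^2$ is the union of all sets $x_1^2+\cdots+x_n^2$, $n\ge1$, $x_i\in A$. $A$ is semi-real if $-1\notin\sum A^2$. A real reduced multiring is a semi-real multiring $A$ such that for all $a,b\in A$: $a^3=a$; $a+b^2a=\{a\}$; $a^2+b^2$ has exactly one element. The multiring $\mathbf 3=\{-1,0,1\}$ has the usual multiplication and negation, and sum $0+x=x+0=\{x\}$, $1+1=\{1\}$, $(-1)+(-1)=\{-1\}$, $1+(-1)=(-1)+1=\{-1,0,1\}$.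 $\mathrm{sper}(A)$ is the set of multiring morphisms $A\to\mathbf 3$. For $A$ semi-real and $a\in A$ let $\hat a\in\mathbf 3^{\mathrm{sper}(A)}$, $\hat a(\sigma)=\sigma(a)$; $Q(A)=\{\hat a: a\in A\}$ with $\hat a\hat b=\widehat{ab}$, $-\hat a=\widehat{-a}$, constants $\hat 0,\hat 1$, and $\hat a\in\hat b+\hat c$ iff there are $a',b',c'\in A$ with $\hat a'=\hat a$, $\hat b'=\hat b$, $\hat c'=\hat c$, $a'\in b'+c'$. It is a multiring. An ideal is a nonempty $\alpha\subseteq A$ with $\alpha+\alpha\subseteq\alpha$, $A\alpha\subseteq\alpha$; it is prime if $1\notin\alpha$ and $ab\in\alpha$ implies $a\in\alpha$ or $b\in\alpha$. $\mathrm{spec}(A)$ is the set of prime ideals, $D(a)=\{p: a\notin p\}$; $(\mathrm{spec}(A))_{const}$ is $\mathrm{spec}(A)$ with the constructible topology (generated by the $D(a)$ and their complements). For a multiplicative set $S$ ($1\in S$, $SS\subseteq S$), $S^{-1}A$ is the multiring of fractions $a/s$, with $a/s=b/t$ iff $atu=bsu$ for some $u\in S$, $a/s\in b/t+c/u$ iff $atuv\in bsuv+cstv$ for some $v\in S$, and $(a/s)(b/t)=ab/st$. For an ideal $I$, $A/I$ is the set of classes of $a\sim b\Leftrightarrow (a-b)\cap I\ne\emptyset$, with $\overline a\in\overline b+\overline c$ iff $a\in b+c+i$ for some $i\in I$, and induced product. For $p\in\mathrm{spec}(A)$, $K_A(p)=((A/p)\setminus\{0\})^{-1}(A/p)$.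 A constructible section is a function $f\colon\mathrm{spec}(A)\to\bigsqcup_{p}K_A(p)$ with $f(p)\in K_A(p)$ such that for each $p$ there are a clopen $U$ of $(\mathrm{spec}(A))_{const}$ and $x,y\in A$ with $p\in U\subseteq D(y)$ and $f(q)=\frac xy\in K_A(q)$ for all $q\in U$. $V(A)$ is the set of constructible sections, with pointwise product, negation and constants and with $f\in g+h$ iff $f(p)\in g(p)+h(p)$ in $K_A(p)$ for all $p$; it is a multiring. *)

theory Defs
  imports "HOL-Algebra.Group" "HOL-Analysis.Function_Topology"
begin

section \<open>Multirings\<close>

record 'a multiring_struct = "'a monoid" +
  mzero :: 'a ("\<zero>\<index>")
  madd :: "'a \<Rightarrow> 'a \<Rightarrow> 'a set" (infixl "\<oplus>\<index>" 65)
  mneg :: "'a \<Rightarrow> 'a" ("\<ominus>\<index> _" [81] 80)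

locale multiring = comm_monoid A for A (structure) +
  assumes zero_closed: "\<zero> \<in> carrier A"
    and neg_closed: "a \<in> carrier A \<Longrightarrow> \<ominus> a \<in> carrier A"
    and add_closed: "\<lbrakk>a \<in> carrier A; b \<in> carrier A\<rbrakk> \<Longrightarrow> a \<oplus> b \<subseteq> carrier A"
    and add_nonempty: "\<lbrakk>a \<in> carrier A; b \<in> carrier A\<rbrakk> \<Longrightarrow> a \<oplus> b \<noteq> {}"
    and add_reverse:
      "\<lbrakk>a \<in> carrier A; b \<in> carrier A; c \<in> carrier A; a \<in> b \<oplus> c\<rbrakk>
        \<Longrightarrow> c \<in> (\<ominus> b) \<oplus> a \<and> b \<in> a \<oplus> (\<ominus> c)"
    and add_zero_iff:
      "\<lbrakk>a \<in> carrier A; b \<in> carrier A\<rbrakk> \<Longrightarrow> a \<in> b \<oplus> \<zero> \<longleftrightarrow> a = b"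
    and add_assoc:
      "\<lbrakk>a \<in> carrier A; b \<in> carrier A; c \<in> carrier A; g \<in> a \<oplus> b; x \<in> g \<oplus> c\<rbrakk>
        \<Longrightarrow> \<exists>h \<in> b \<oplus> c. x \<in> a \<oplus> h"
    and add_comm: "\<lbrakk>a \<in> carrier A; b \<in> carrier A\<rbrakk> \<Longrightarrow> a \<oplus> b = b \<oplus> a"
    and mult_zero: "a \<in> carrier A \<Longrightarrow> a \<otimes> \<zero> = \<zero>"
    and add_mult:
      "\<lbrakk>a \<in> carrier A; b \<in> carrier A; c \<in> carrier A; d \<in> carrier A; a \<in> b \<oplus> c\<rbrakk>
        \<Longrightarrow> a \<otimes> d \<in> (b \<otimes> d) \<oplus> (c \<otimes> d)"

locale hyperring = multiring +
  assumes hyperdistrib: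
    "\<lbrakk>b \<in> carrier A; c \<in> carrier A; d \<in> carrier A; x \<in> (b \<otimes> d) \<oplus> (c \<otimes> d)\<rbrakk>
      \<Longrightarrow> \<exists>a \<in> b \<oplus> c. x = a \<otimes> d"

locale von_neumann_hyperring = hyperring +
  assumes regular: "a \<in> carrier A \<Longrightarrow> \<exists>b \<in> carrier A. a = a [^] (2::nat) \<otimes> b"

text \<open>Morphisms are extensional on the carrier, so that sets of morphisms contain each morphism once.\<close>

definition multiring_hom ::
  "('a, 'm) multiring_struct_scheme \<Rightarrow> ('b, 'n) multiring_struct_scheme \<Rightarrow> ('a \<Rightarrow> 'b) set" where
  "multiring_hom A B = {f \<in> carrier A \<rightarrow>\<^sub>E carrier B.
     (\<forall>a \<in> carrier A. \<forall>b \<in> carrier A. \<forall>c \<in> carrier A.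
        a \<in> b \<oplus>\<^bsub>A\<^esub> c \<longrightarrow> f a \<in> f b \<oplus>\<^bsub>B\<^esub> f c) \<and>
     (\<forall>a \<in> carrier A. \<forall>b \<in> carrier A. f (a \<otimes>\<^bsub>A\<^esub> b) = f a \<otimes>\<^bsub>B\<^esub> f b) \<and>
     (\<forall>a \<in> carrier A. f (\<ominus>\<^bsub>A\<^esub> a) = \<ominus>\<^bsub>B\<^esub> f a) \<and>
     f \<zero>\<^bsub>A\<^esub> = \<zero>\<^bsub>B\<^esub> \<and> f \<one>\<^bsub>A\<^esub> = \<one>\<^bsub>B\<^esub>}"

definition set_madd :: "('a, 'm) multiring_struct_scheme \<Rightarrow> 'a set \<Rightarrow> 'a set \<Rightarrow> 'a set"
  (infixl "\<uplus>\<index>" 65) where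
  "X \<uplus>\<^bsub>A\<^esub> Y = (\<Union>x \<in> X. \<Union>y \<in> Y. x \<oplus>\<^bsub>A\<^esub> y)"


section \<open>Sums of squares and real reduced multirings\<close>

fun list_madd :: "('a, 'm) multiring_struct_scheme \<Rightarrow> 'a list \<Rightarrow> 'a set" where
  "list_madd A [] = {\<zero>\<^bsub>A\<^esub>}"
| "list_madd A [x] = {x}"
| "list_madd A (x # y # zs) = {x} \<uplus>\<^bsub>A\<^esub> list_madd A (y # zs)"

definition sums_of_squares :: "('a, 'm) multiring_struct_scheme \<Rightarrow> 'a set" where
  "sums_of_squares A =
     (\<Union>xs \<in> {xs. xs \<noteq> [] \<and> set xs \<subseteq> carrier A}. list_madd A (map (\<lambda>x. x [^]\<^bsub>A\<^esub> (2::nat)) xs))"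

definition semireal :: "('a, 'm) multiring_struct_scheme \<Rightarrow> bool" where
  "semireal A \<longleftrightarrow> \<ominus>\<^bsub>A\<^esub> \<one>\<^bsub>A\<^esub> \<notin> sums_of_squares A"

locale real_reduced_multiring = multiring +
  assumes semireal: "semireal A"
    and cube: "a \<in> carrier A \<Longrightarrow> a [^] (3::nat) = a"
    and add_square_mult:
      "\<lbrakk>a \<in> carrier A; b \<in> carrier A\<rbrakk> \<Longrightarrow> a \<oplus> (b [^] (2::nat) \<otimes> a) = {a}"
    and square_add_square:
      "\<lbrakk>a \<in> carrier A; b \<in> carrier A\<rbrakk> \<Longrightarrow> \<exists>!x. x \<in> a [^] (2::nat) \<oplus> b [^] (2::nat)"


section \<open>The real reduced quotient\<close>

definition three :: "int multiring_struct" where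
  "three = \<lparr>carrier = {- 1, 0, 1}, mult = (*), one = 1, mzero = 0,
     madd = (\<lambda>x y. if x = 0 then {y} else if y = 0 then {x} else if x = y then {x} else {- 1, 0, 1}),
     mneg = uminus\<rparr>"

definition sper :: "('a, 'm) multiring_struct_scheme \<Rightarrow> ('a \<Rightarrow> int) set" where
  "sper A = multiring_hom A three"

definition hat :: "('a, 'm) multiring_struct_scheme \<Rightarrow> 'a \<Rightarrow> ('a \<Rightarrow> int) \<Rightarrow> int" where
  "hat A a = (\<lambda>\<sigma> \<in> sper A. \<sigma> a)"

text \<open>Product and negation are those of the power of \<^term>\<open>three\<close>; that they are induced by the
  operations of \<open>A\<close> is \<open>hat_mult\<close> and \<open>hat_neg\<close> below.\<close>

definition multiring_Q :: "('a, 'm) multiring_struct_scheme \<Rightarrow> (('a \<Rightarrow> int) \<Rightarrow> int) multiring_struct" where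
  "multiring_Q A = \<lparr>carrier = hat A ` carrier A,
     mult = (\<lambda>f g. \<lambda>\<sigma> \<in> sper A. f \<sigma> \<otimes>\<^bsub>three\<^esub> g \<sigma>),
     one = hat A \<one>\<^bsub>A\<^esub>,
     mzero = hat A \<zero>\<^bsub>A\<^esub>,
     madd = (\<lambda>g h. {f. \<exists>a \<in> carrier A. \<exists>b \<in> carrier A. \<exists>c \<in> carrier A.
       f = hat A a \<and> g = hat A b \<and> h = hat A c \<and> a \<in> b \<oplus>\<^bsub>A\<^esub> c}),
     mneg = (\<lambda>f. \<lambda>\<sigma> \<in> sper A. \<ominus>\<^bsub>three\<^esub> f \<sigma>)\<rparr>"


section \<open>Prime ideals and the constructible topology\<close>

definition mideal :: "('a, 'm) multiring_struct_scheme \<Rightarrow> 'a set \<Rightarrow> bool" where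
  "mideal A I \<longleftrightarrow> I \<noteq> {} \<and> I \<subseteq> carrier A \<and> I \<uplus>\<^bsub>A\<^esub> I \<subseteq> I \<and>
     (\<forall>a \<in> carrier A. \<forall>i \<in> I. a \<otimes>\<^bsub>A\<^esub> i \<in> I)"

definition prime_mideal :: "('a, 'm) multiring_struct_scheme \<Rightarrow> 'a set \<Rightarrow> bool" where
  "prime_mideal A p \<longleftrightarrow> mideal A p \<and> \<one>\<^bsub>A\<^esub> \<notin> p \<and>
     (\<forall>a \<in> carrier A. \<forall>b \<in> carrier A. a \<otimes>\<^bsub>A\<^esub> b \<in> p \<longrightarrow> a \<in> p \<or> b \<in> p)"

definition spec :: "('a, 'm) multiring_struct_scheme \<Rightarrow> 'a set set" where
  "spec A = {p. prime_mideal A p}"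

definition basic_open :: "('a, 'm) multiring_struct_scheme \<Rightarrow> 'a \<Rightarrow> 'a set set" where
  "basic_open A a = {p \<in> spec A. a \<notin> p}"

definition constructible_topology :: "('a, 'm) multiring_struct_scheme \<Rightarrow> 'a set topology" where
  "constructible_topology A = topology_generated_by
     (basic_open A ` carrier A \<union> (\<lambda>a. spec A - basic_open A a) ` carrier A)"


section \<open>Fractions, quotients and residue multifields\<close>

definition frac_rel :: "('a, 'm) multiring_struct_scheme \<Rightarrow> 'a set \<Rightarrow> (('a \<times> 'a) \<times> ('a \<times> 'a)) set" where
  "frac_rel A S = {((a, s), (b, t)). a \<in> carrier A \<and> s \<in> S \<and> b \<in> carrier A \<and> t \<in> S \<and>
     (\<exists>u \<in> S. a \<otimes>\<^bsub>A\<^esub> t \<otimes>\<^bsub>A\<^esub> u = b \<otimes>\<^bsub>A\<^esub> s \<otimes>\<^bsub>A\<^esub> u)}"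

definition fraction :: "('a, 'm) multiring_struct_scheme \<Rightarrow> 'a set \<Rightarrow> 'a \<Rightarrow> 'a \<Rightarrow> ('a \<times> 'a) set" where
  "fraction A S a s = frac_rel A S `` {(a, s)}"

text \<open>The unions in the product and the negation (here and in the quotient) range over all
  representatives; all sets in such a union coincide.\<close>

definition fractions :: "('a, 'm) multiring_struct_scheme \<Rightarrow> 'a set \<Rightarrow> ('a \<times> 'a) set multiring_struct" where
  "fractions A S = \<lparr>carrier = (carrier A \<times> S) // frac_rel A S,
     mult = (\<lambda>X Y. \<Union>(a, s) \<in> X. \<Union>(b, t) \<in> Y. fraction A S (a \<otimes>\<^bsub>A\<^esub> b) (s \<otimes>\<^bsub>A\<^esub> t)),
     one = fraction A S \<one>\<^bsub>A\<^esub> \<one>\<^bsub>A\<^esub>,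
     mzero = fraction A S \<zero>\<^bsub>A\<^esub> \<one>\<^bsub>A\<^esub>,
     madd = (\<lambda>Y Z. {X. \<exists>a \<in> carrier A. \<exists>b \<in> carrier A. \<exists>c \<in> carrier A. \<exists>s \<in> S. \<exists>t \<in> S. \<exists>u \<in> S.
       X = fraction A S a s \<and> Y = fraction A S b t \<and> Z = fraction A S c u \<and>
       (\<exists>v \<in> S. a \<otimes>\<^bsub>A\<^esub> t \<otimes>\<^bsub>A\<^esub> u \<otimes>\<^bsub>A\<^esub> v
                  \<in> (b \<otimes>\<^bsub>A\<^esub> s \<otimes>\<^bsub>A\<^esub> u \<otimes>\<^bsub>A\<^esub> v) \<oplus>\<^bsub>A\<^esub> (c \<otimes>\<^bsub>A\<^esub> s \<otimes>\<^bsub>A\<^esub> t \<otimes>\<^bsub>A\<^esub> v))}),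
     mneg = (\<lambda>X. \<Union>(a, s) \<in> X. fraction A S (\<ominus>\<^bsub>A\<^esub> a) s)\<rparr>"

definition quot_rel :: "('a, 'm) multiring_struct_scheme \<Rightarrow> 'a set \<Rightarrow> ('a \<times> 'a) set" where
  "quot_rel A I = {(a, b). a \<in> carrier A \<and> b \<in> carrier A \<and> (a \<oplus>\<^bsub>A\<^esub> (\<ominus>\<^bsub>A\<^esub> b)) \<inter> I \<noteq> {}}"

definition quot_class :: "('a, 'm) multiring_struct_scheme \<Rightarrow> 'a set \<Rightarrow> 'a \<Rightarrow> 'a set" where
  "quot_class A I a = quot_rel A I `` {a}"

definition quot :: "('a, 'm) multiring_struct_scheme \<Rightarrow> 'a set \<Rightarrow> 'a set multiring_struct" where
  "quot A I = \<lparr>carrier = carrier A // quot_rel A I,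
     mult = (\<lambda>X Y. \<Union>a \<in> X. \<Union>b \<in> Y. quot_class A I (a \<otimes>\<^bsub>A\<^esub> b)),
     one = quot_class A I \<one>\<^bsub>A\<^esub>,
     mzero = quot_class A I \<zero>\<^bsub>A\<^esub>,
     madd = (\<lambda>Y Z. {X. \<exists>a \<in> carrier A. \<exists>b \<in> carrier A. \<exists>c \<in> carrier A.
       X = quot_class A I a \<and> Y = quot_class A I b \<and> Z = quot_class A I c \<and>
       (\<exists>i \<in> I. a \<in> (b \<oplus>\<^bsub>A\<^esub> c) \<uplus>\<^bsub>A\<^esub> {i})}),
     mneg = (\<lambda>X. \<Union>a \<in> X. quot_class A I (\<ominus>\<^bsub>A\<^esub> a))\<rparr>"

definition nonzero_classes :: "('a, 'm) multiring_struct_scheme \<Rightarrow> 'a set \<Rightarrow> 'a set set" where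
  "nonzero_classes A p = carrier (quot A p) - {\<zero>\<^bsub>quot A p\<^esub>}"

definition residue_multifield :: "('a, 'm) multiring_struct_scheme \<Rightarrow> 'a set \<Rightarrow> ('a set \<times> 'a set) set multiring_struct" where
  "residue_multifield A p = fractions (quot A p) (nonzero_classes A p)"

definition residue_fraction :: "('a, 'm) multiring_struct_scheme \<Rightarrow> 'a set \<Rightarrow> 'a \<Rightarrow> 'a \<Rightarrow> ('a set \<times> 'a set) set" where
  "residue_fraction A p x y = fraction (quot A p) (nonzero_classes A p) (quot_class A p x) (quot_class A p y)"


section \<open>Constructible sections\<close>

definition constructible_sections ::
  "('a, 'm) multiring_struct_scheme \<Rightarrow> ('a set \<Rightarrow> ('a set \<times> 'a set) set) set" where
  "constructible_sections A = {f \<in> (\<Pi>\<^sub>E p \<in> spec A. carrier (residue_multifield A p)).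
     \<forall>p \<in> spec A. \<exists>U. \<exists>x \<in> carrier A. \<exists>y \<in> carrier A.
       openin (constructible_topology A) U \<and> closedin (constructible_topology A) U \<and>
       p \<in> U \<and> U \<subseteq> basic_open A y \<and> (\<forall>q \<in> U. f q = residue_fraction A q x y)}"

definition multiring_V :: "('a, 'm) multiring_struct_scheme \<Rightarrow> ('a set \<Rightarrow> ('a set \<times> 'a set) set) multiring_struct" where
  "multiring_V A = \<lparr>carrier = constructible_sections A,
     mult = (\<lambda>f g. \<lambda>p \<in> spec A. f p \<otimes>\<^bsub>residue_multifield A p\<^esub> g p),
     one = (\<lambda>p \<in> spec A. \<one>\<^bsub>residue_multifield A p\<^esub>),
     mzero = (\<lambda>p \<in> spec A. \<zero>\<^bsub>residue_multifield A p\<^esub>),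
     madd = (\<lambda>g h. {f \<in> constructible_sections A. \<forall>p \<in> spec A. f p \<in> g p \<oplus>\<^bsub>residue_multifield A p\<^esub> h p}),
     mneg = (\<lambda>f. \<lambda>p \<in> spec A. \<ominus>\<^bsub>residue_multifield A p\<^esub> f p)\<rparr>"


section \<open>The constructions are independent of representatives\<close>

lemma hat_mult:
  assumes "a \<in> carrier A" "b \<in> carrier A"
  shows "hat A a \<otimes>\<^bsub>multiring_Q A\<^esub> hat A b = hat A (a \<otimes>\<^bsub>A\<^esub> b)"
  using assms by (auto simp: hat_def multiring_Q_def sper_def multiring_hom_def restrict_def fun_eq_iff)

lemma hat_neg:
  assumes "a \<in> carrier A"
  shows "\<ominus>\<^bsub>multiring_Q A\<^esub> hat A a = hat A (\<ominus>\<^bsub>A\<^esub> a)"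
  using assms by (auto simp: hat_def multiring_Q_def sper_def multiring_hom_def restrict_def fun_eq_iff)

lemma multiring_three: "multiring three"
proof -
  have carr: "carrier three = {- 1, 0, 1}" and ops: "mult three = (*)" "one three = 1"
      "mzero three = 0" "mneg three = uminus"
    and add: "\<And>x y. madd three x y =
      (if x = 0 then {y} else if y = 0 then {x} else if x = y then {x} else {- 1, 0, 1})"
    by (simp_all add: three_def)
  show ?thesis
    unfolding multiring_def multiring_axioms_def
  proof (intro conjI allI impI)
    show "comm_monoid three"
      by (rule comm_monoidI) (auto simp: carr ops)
  next
    fix a b c g x assume "a \<in> carrier three" "b \<in> carrier three" "c \<in> carrier three"
      and "g \<in> madd three a b" "x \<in> madd three g c"
    thus "\<exists>h \<in> madd three b c. x \<in> madd three a h"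
      unfolding carr add by (elim insertE emptyE) (simp_all, (auto split: if_splits)?)
  qed (unfold carr ops add, (simp; fail | (elim insertE emptyE; simp))+)
qed

lemma topspace_constructible_topology:
  assumes "\<one>\<^bsub>A\<^esub> \<in> carrier A"
  shows "topspace (constructible_topology A) = spec A"
proof -
  have "basic_open A \<one>\<^bsub>A\<^esub> = spec A"
    by (auto simp: basic_open_def spec_def prime_mideal_def)
  with assms have "spec A \<in> basic_open A ` carrier A" by (metis imageI)
  moreover have "basic_open A a \<subseteq> spec A" for a by (auto simp: basic_open_def)
  ultimately show ?thesis
    unfolding constructible_topology_def topology_generated_by_topspace by blast
qed

context multiring
begin

lemma neg_neg: assumes "a \<in> carrier A" shows "\<ominus> (\<ominus> a) = a"
proof -
  have "a \<in> a \<oplus> \<zero>" using assms add_zero_iff by blast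
  hence "\<zero> \<in> (\<ominus> a) \<oplus> a" using add_reverse[of a a \<zero>] assms zero_closed by blast
  hence "a \<in> (\<ominus> (\<ominus> a)) \<oplus> \<zero>"
    using add_reverse[of \<zero> "\<ominus> a" a] assms zero_closed neg_closed by blast
  thus ?thesis using add_zero_iff[of a "\<ominus> (\<ominus> a)"] assms neg_closed by simp
qed

lemma zero_add_neg: assumes "a \<in> carrier A" shows "\<zero> \<in> a \<oplus> (\<ominus> a)"
proof -
  have "a \<in> a \<oplus> \<zero>" using assms add_zero_iff by blast
  hence "a \<in> \<zero> \<oplus> a" using add_comm[OF assms zero_closed] by simp
  thus ?thesis using add_reverse[of a \<zero> a] assms zero_closed by blast
qed

lemma neg_mult: assumes "a \<in> carrier A" "b \<in> carrier A" shows "(\<ominus> a) \<otimes> b = \<ominus> (a \<otimes> b)"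
proof -
  have "\<zero> \<in> a \<oplus> (\<ominus> a)" using assms zero_add_neg by blast
  hence "\<zero> \<otimes> b \<in> (a \<otimes> b) \<oplus> ((\<ominus> a) \<otimes> b)"
    using add_mult assms neg_closed zero_closed by blast
  moreover have "\<zero> \<otimes> b = \<zero>"
    using m_comm[OF zero_closed assms(2)] mult_zero[OF assms(2)] by simp
  ultimately have "(\<ominus> a) \<otimes> b \<in> (\<ominus> (a \<otimes> b)) \<oplus> \<zero>"
    using add_reverse[of \<zero> "a \<otimes> b" "(\<ominus> a) \<otimes> b"] assms neg_closed zero_closed by auto
  thus ?thesis using add_zero_iff[of "(\<ominus> a) \<otimes> b" "\<ominus> (a \<otimes> b)"] assms neg_closed by simp
qed

lemma set_madd_closed:
  assumes "X \<subseteq> carrier A" "Y \<subseteq> carrier A"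
  shows "X \<uplus> Y \<subseteq> carrier A"
  unfolding set_madd_def using assms by (intro UN_least add_closed) auto

lemma set_madd_comm:
  assumes "X \<subseteq> carrier A" "Y \<subseteq> carrier A"
  shows "X \<uplus> Y = Y \<uplus> X"
proof -
  have "x \<oplus> y = y \<oplus> x" if "x \<in> X" "y \<in> Y" for x y
    using that assms by (intro add_comm) auto
  thus ?thesis unfolding set_madd_def by blast
qed

lemma set_madd_assoc_le:
  assumes "X \<subseteq> carrier A" "Y \<subseteq> carrier A" "Z \<subseteq> carrier A"
  shows "(X \<uplus> Y) \<uplus> Z \<subseteq> X \<uplus> (Y \<uplus> Z)"
proof
  fix w assume "w \<in> (X \<uplus> Y) \<uplus> Z"
  then obtain x y z g where *: "x \<in> X" "y \<in> Y" "z \<in> Z" "g \<in> x \<oplus> y" "w \<in> g \<oplus> z"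
    unfolding set_madd_def by blast
  then obtain h where "h \<in> y \<oplus> z" "w \<in> x \<oplus> h"
    using add_assoc[of x y z g w] assms by blast
  with * show "w \<in> X \<uplus> (Y \<uplus> Z)" unfolding set_madd_def by blast
qed

lemma set_madd_assoc:
  assumes "X \<subseteq> carrier A" "Y \<subseteq> carrier A" "Z \<subseteq> carrier A"
  shows "(X \<uplus> Y) \<uplus> Z = X \<uplus> (Y \<uplus> Z)"
proof
  note closed = set_madd_closed[OF assms(1,2)] set_madd_closed[OF assms(2,3)]
  have "X \<uplus> (Y \<uplus> Z) = (Z \<uplus> Y) \<uplus> X"
    unfolding set_madd_comm[OF assms(3,2)] by (rule set_madd_comm[OF assms(1) closed(2)])
  also have "\<dots> \<subseteq> Z \<uplus> (Y \<uplus> X)" by (rule set_madd_assoc_le[OF assms(3,2,1)])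
  also have "\<dots> = (X \<uplus> Y) \<uplus> Z"
    unfolding set_madd_comm[OF assms(2,1)] by (rule set_madd_comm[OF assms(3) closed(1)])
  finally show "X \<uplus> (Y \<uplus> Z) \<subseteq> (X \<uplus> Y) \<uplus> Z" .
qed (rule set_madd_assoc_le[OF assms])

lemma set_madd_mono: "X \<subseteq> X' \<Longrightarrow> Y \<subseteq> Y' \<Longrightarrow> X \<uplus> Y \<subseteq> X' \<uplus> Y'"
  unfolding set_madd_def by (intro UN_mono) auto

end


subsection \<open>Quotients\<close>

locale multiring_ideal = multiring +
  fixes I
  assumes mideal: "mideal A I"
begin

lemma ideal_subset: "I \<subseteq> carrier A"
  and ideal_add: "I \<uplus> I \<subseteq> I"
  and ideal_mult: "\<And>a i. \<lbrakk>a \<in> carrier A; i \<in> I\<rbrakk> \<Longrightarrow> a \<otimes> i \<in> I"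
  and ideal_nonempty: "I \<noteq> {}"
  using mideal unfolding mideal_def by blast+

lemma ideal_neg: assumes "i \<in> I" shows "\<ominus> i \<in> I"
proof -
  have "(\<ominus> \<one>) \<otimes> i \<in> I" using assms ideal_mult neg_closed by blast
  thus ?thesis using neg_mult[of \<one> i] assms ideal_subset by auto
qed

lemma ideal_zero: "\<zero> \<in> I"
proof -
  obtain i where i: "i \<in> I" using ideal_nonempty by blast
  hence c: "i \<in> carrier A" using ideal_subset by blast
  have "\<zero> \<otimes> i \<in> I" using i by (rule ideal_mult[OF zero_closed])
  thus ?thesis using m_comm[OF zero_closed c] mult_zero[OF c] by simp
qed

lemma quot_rel_iff:
  "(a, b) \<in> quot_rel A I \<longleftrightarrow> a \<in> carrier A \<and> b \<in> carrier A \<and> a \<in> {b} \<uplus> I"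
proof -
  have "(a \<oplus> (\<ominus> b)) \<inter> I \<noteq> {} \<longleftrightarrow> a \<in> {b} \<uplus> I" if ab: "a \<in> carrier A" "b \<in> carrier A"
  proof
    assume "(a \<oplus> (\<ominus> b)) \<inter> I \<noteq> {}"
    then obtain i where i: "i \<in> I" "i \<in> a \<oplus> (\<ominus> b)" by blast
    hence "a \<in> i \<oplus> (\<ominus> (\<ominus> b))" using add_reverse[of i a "\<ominus> b"] ab neg_closed ideal_subset by blast
    hence "a \<in> b \<oplus> i" using neg_neg add_comm ab i ideal_subset by (metis subsetD)
    thus "a \<in> {b} \<uplus> I" using i unfolding set_madd_def by blast
  next
    assume "a \<in> {b} \<uplus> I"
    then obtain i where i: "i \<in> I" "a \<in> b \<oplus> i" unfolding set_madd_def by blast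
    hence "i \<in> (\<ominus> b) \<oplus> a" using add_reverse[of a b i] ab ideal_subset by blast
    hence "i \<in> a \<oplus> (\<ominus> b)" using add_comm ab neg_closed by blast
    thus "(a \<oplus> (\<ominus> b)) \<inter> I \<noteq> {}" using i by blast
  qed
  thus ?thesis unfolding quot_rel_def by blast
qed

lemma equiv_quot_rel: "equiv (carrier A) (quot_rel A I)"
proof (rule equivI)
  show "quot_rel A I \<subseteq> carrier A \<times> carrier A" unfolding quot_rel_def by auto
  show "refl_on (carrier A) (quot_rel A I)"
    using ideal_zero zero_add_neg unfolding quot_rel_def refl_on_def by blast
  show "sym (quot_rel A I)"
  proof (rule symI)
    fix a b assume ab: "(a, b) \<in> quot_rel A I"
    then obtain i where i: "i \<in> I" "a \<in> b \<oplus> i" and c: "a \<in> carrier A" "b \<in> carrier A"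
      unfolding quot_rel_iff set_madd_def by blast
    hence "b \<in> a \<oplus> (\<ominus> i)" using add_reverse[of a b i] ideal_subset by blast
    thus "(b, a) \<in> quot_rel A I"
      using c i ideal_neg unfolding quot_rel_iff set_madd_def by blast
  qed
  show "trans (quot_rel A I)"
  proof (rule transI)
    fix a b c assume ab: "(a, b) \<in> quot_rel A I" and bc: "(b, c) \<in> quot_rel A I"
    have cc: "c \<in> carrier A" using bc unfolding quot_rel_iff by blast
    have "a \<in> {b} \<uplus> I" using ab unfolding quot_rel_iff by blast
    also have "{b} \<uplus> I \<subseteq> ({c} \<uplus> I) \<uplus> I"
      using bc unfolding quot_rel_iff by (intro set_madd_mono) auto
    also have "\<dots> = {c} \<uplus> (I \<uplus> I)" using set_madd_assoc cc ideal_subset by simp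
    also have "\<dots> \<subseteq> {c} \<uplus> I" using ideal_add set_madd_mono by blast
    finally show "(a, c) \<in> quot_rel A I" using ab bc unfolding quot_rel_iff by blast
  qed
qed

lemma quot_class_eq_iff:
  "a \<in> carrier A \<Longrightarrow> b \<in> carrier A \<Longrightarrow>
    quot_class A I a = quot_class A I b \<longleftrightarrow> (a \<oplus> (\<ominus> b)) \<inter> I \<noteq> {}"
proof -
  assume "a \<in> carrier A" "b \<in> carrier A"
  hence "quot_class A I a = quot_class A I b \<longleftrightarrow> (a, b) \<in> quot_rel A I"
    unfolding quot_class_def by (rule eq_equiv_class_iff[OF equiv_quot_rel])
  with \<open>a \<in> carrier A\<close> \<open>b \<in> carrier A\<close> show ?thesis by (simp add: quot_rel_def)
qed

lemma quot_rel_mult: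
  assumes "(a, a') \<in> quot_rel A I" "c \<in> carrier A"
  shows "(a \<otimes> c, a' \<otimes> c) \<in> quot_rel A I"
proof -
  obtain i where i: "i \<in> I" "a \<in> a' \<oplus> i" and c: "a \<in> carrier A" "a' \<in> carrier A"
    using assms unfolding quot_rel_iff set_madd_def by blast
  hence "a \<otimes> c \<in> (a' \<otimes> c) \<oplus> (i \<otimes> c)" using add_mult assms ideal_subset by blast
  moreover have "i \<otimes> c \<in> I" using ideal_mult[of c i] m_comm[of c i] i assms ideal_subset by auto
  ultimately show ?thesis using c assms unfolding quot_rel_iff set_madd_def by blast
qed

lemma UN_quot_class:
  assumes "a \<in> carrier A" "\<And>b. (a, b) \<in> quot_rel A I \<Longrightarrow> F b = F a"
  shows "(\<Union>b \<in> quot_class A I a. F b) = F a"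
proof -
  have "a \<in> quot_class A I a"
    using equiv_class_self[OF equiv_quot_rel] assms(1) unfolding quot_class_def by blast
  moreover have "F b = F a" if "b \<in> quot_class A I a" for b
    using that assms(2) unfolding quot_class_def by blast
  ultimately show ?thesis by blast
qed

lemma quot_class_cong: "(a, b) \<in> quot_rel A I \<Longrightarrow> quot_class A I b = quot_class A I a"
  unfolding quot_class_def using equiv_class_eq[OF equiv_quot_rel] by metis

lemma quot_mult:
  assumes "a \<in> carrier A" "b \<in> carrier A"
  shows "quot_class A I a \<otimes>\<^bsub>quot A I\<^esub> quot_class A I b = quot_class A I (a \<otimes> b)"
proof -
  have in_carr: "x \<in> carrier A" "y \<in> carrier A" if "(x, y) \<in> quot_rel A I" for x y
    using that unfolding quot_rel_def by auto
  have inner: "(\<Union>y \<in> quot_class A I b. quot_class A I (x \<otimes> y)) = quot_class A I (x \<otimes> b)"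
    if "x \<in> carrier A" for x
    using assms that in_carr quot_rel_mult m_comm
    by (intro UN_quot_class quot_class_cong) metis+
  have "(\<Union>x \<in> quot_class A I a. \<Union>y \<in> quot_class A I b. quot_class A I (x \<otimes> y))
      = (\<Union>y \<in> quot_class A I b. quot_class A I (a \<otimes> y))"
    using assms inner in_carr quot_rel_mult quot_class_cong
    by (intro UN_quot_class) metis+
  thus ?thesis using inner assms by (simp add: quot_def)
qed

lemma quot_neg:
  assumes "a \<in> carrier A"
  shows "\<ominus>\<^bsub>quot A I\<^esub> quot_class A I a = quot_class A I (\<ominus> a)"
proof -
  have "quot_class A I (\<ominus> b) = quot_class A I (\<ominus> a)" if ab: "(a, b) \<in> quot_rel A I" for b
  proof -
    have c: "b \<in> carrier A" using ab unfolding quot_rel_def by auto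
    have "((\<ominus> a), (\<ominus> b)) \<in> quot_rel A I"
      using quot_rel_mult[OF ab, of "\<ominus> \<one>"] assms c neg_closed neg_mult m_comm
      by (metis l_one one_closed)
    thus ?thesis by (rule quot_class_cong)
  qed
  from UN_quot_class[of a "\<lambda>b. quot_class A I (\<ominus> b)", OF assms this] show ?thesis
    by (simp add: quot_def)
qed

lemma quot_madd:
  assumes "a \<in> carrier A" "b \<in> carrier A" "c \<in> carrier A"
  shows "quot_class A I a \<in> quot_class A I b \<oplus>\<^bsub>quot A I\<^esub> quot_class A I c
    \<longleftrightarrow> (\<exists>i \<in> I. a \<in> (b \<oplus> c) \<uplus> {i})"
proof
  assume "\<exists>i \<in> I. a \<in> (b \<oplus> c) \<uplus> {i}"
  thus "quot_class A I a \<in> quot_class A I b \<oplus>\<^bsub>quot A I\<^esub> quot_class A I c"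
    using assms by (auto simp: quot_def)
next
  assume "quot_class A I a \<in> quot_class A I b \<oplus>\<^bsub>quot A I\<^esub> quot_class A I c"
  then obtain a' b' c' i where c': "a' \<in> carrier A" "b' \<in> carrier A" "c' \<in> carrier A"
    and eq: "quot_class A I a = quot_class A I a'" "quot_class A I b' = quot_class A I b"
      "quot_class A I c' = quot_class A I c"
    and i: "i \<in> I" "a' \<in> (b' \<oplus> c') \<uplus> {i}"
    by (auto simp: quot_def)
  have le: "{x} \<subseteq> {y} \<uplus> I"
    if "quot_class A I x = quot_class A I y" "x \<in> carrier A" "y \<in> carrier A" for x y
    using that quot_class_eq_iff[of x y] quot_rel_iff[of x y] unfolding quot_rel_def by simp
  have bc: "b' \<oplus> c' = {b'} \<uplus> {c'}" "b \<oplus> c = {b} \<uplus> {c}" unfolding set_madd_def by auto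
  note [simp] = assms c' ideal_subset set_madd_closed
  have II: "I \<uplus> I = I"
  proof
    have "x \<in> I \<uplus> I" if "x \<in> I" for x
    proof -
      have "x \<in> x \<oplus> \<zero>" using that ideal_subset add_zero_iff by blast
      thus ?thesis using that ideal_zero unfolding set_madd_def by blast
    qed
    thus "I \<subseteq> I \<uplus> I" by blast
  qed (rule ideal_add)
  have "{a} \<subseteq> {a'} \<uplus> I" using le eq by simp
  also have "\<dots> \<subseteq> (({b'} \<uplus> {c'}) \<uplus> I) \<uplus> I"
    using i unfolding bc by (intro set_madd_mono) (auto simp: set_madd_def)
  also have "\<dots> \<subseteq> ((({b} \<uplus> I) \<uplus> ({c} \<uplus> I)) \<uplus> I) \<uplus> I"
    using le eq by (intro set_madd_mono) auto
  also have "\<dots> = ({b} \<uplus> (I \<uplus> {c})) \<uplus> (I \<uplus> (I \<uplus> I))"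
    by (simp add: set_madd_assoc)
  also have "I \<uplus> {c} = {c} \<uplus> I" by (simp add: set_madd_comm)
  also have "({b} \<uplus> ({c} \<uplus> I)) \<uplus> (I \<uplus> (I \<uplus> I)) = ({b} \<uplus> {c}) \<uplus> I"
    by (simp add: set_madd_assoc II)
  finally show "\<exists>i \<in> I. a \<in> (b \<oplus> c) \<uplus> {i}"
    unfolding bc by (auto simp: set_madd_def)
qed

end


subsection \<open>Fractions\<close>

locale multiring_fractions = multiring +
  fixes S
  assumes S_subset: "S \<subseteq> carrier A"
    and S_one: "\<one> \<in> S"
    and S_mult: "\<lbrakk>s \<in> S; t \<in> S\<rbrakk> \<Longrightarrow> s \<otimes> t \<in> S"
begin

lemma S_carrier [simp]: "s \<in> S \<Longrightarrow> s \<in> carrier A"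
  using S_subset by blast

lemma equiv_frac_rel: "equiv (carrier A \<times> S) (frac_rel A S)"
proof (rule equivI)
  show "frac_rel A S \<subseteq> (carrier A \<times> S) \<times> carrier A \<times> S" unfolding frac_rel_def by auto
  show "refl_on (carrier A \<times> S) (frac_rel A S)"
    using S_one unfolding frac_rel_def refl_on_def by auto
  show "sym (frac_rel A S)"
  proof (rule symI)
    fix x y assume "(x, y) \<in> frac_rel A S"
    then obtain a s b t u where "x = (a, s)" "y = (b, t)" "a \<in> carrier A" "b \<in> carrier A"
      "s \<in> S" "t \<in> S" "u \<in> S" "b \<otimes> s \<otimes> u = a \<otimes> t \<otimes> u"
      unfolding frac_rel_def by auto
    thus "(y, x) \<in> frac_rel A S" unfolding frac_rel_def by blast
  qed
  show "trans (frac_rel A S)"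
  proof (rule transI)
    fix x y z assume "(x, y) \<in> frac_rel A S" "(y, z) \<in> frac_rel A S"
    then obtain a s b t c r u v where x: "x = (a, s)" "y = (b, t)" "z = (c, r)"
      and c: "a \<in> carrier A" "b \<in> carrier A" "c \<in> carrier A" "s \<in> S" "t \<in> S" "r \<in> S" "u \<in> S" "v \<in> S"
      and e: "a \<otimes> t \<otimes> u = b \<otimes> s \<otimes> u" "b \<otimes> r \<otimes> v = c \<otimes> t \<otimes> v"
      unfolding frac_rel_def by auto
    note [simp] = c
    have "a \<otimes> r \<otimes> (t \<otimes> u \<otimes> v) = (a \<otimes> t \<otimes> u) \<otimes> (r \<otimes> v)" by (simp add: m_ac)
    also have "\<dots> = (b \<otimes> r \<otimes> v) \<otimes> (s \<otimes> u)" unfolding e(1) by (simp add: m_ac)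
    also have "\<dots> = c \<otimes> s \<otimes> (t \<otimes> u \<otimes> v)" unfolding e(2) by (simp add: m_ac)
    finally show "(x, z) \<in> frac_rel A S"
      using c S_mult unfolding frac_rel_def x by auto
  qed
qed

lemma frac_eq_iff:
  assumes "a \<in> carrier A" "b \<in> carrier A" "s \<in> S" "t \<in> S"
  shows "fraction A S a s = fraction A S b t \<longleftrightarrow> (\<exists>u \<in> S. a \<otimes> t \<otimes> u = b \<otimes> s \<otimes> u)"
  unfolding fraction_def using eq_equiv_class_iff[OF equiv_frac_rel, of "(a, s)" "(b, t)"] assms
  by (auto simp: frac_rel_def)

lemma UN_frac:
  assumes "a \<in> carrier A" "s \<in> S"
    "\<And>b t u. \<lbrakk>b \<in> carrier A; t \<in> S; u \<in> S; a \<otimes> t \<otimes> u = b \<otimes> s \<otimes> u\<rbrakk> \<Longrightarrow> F b t = F a s"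
  shows "(\<Union>(b, t) \<in> fraction A S a s. F b t) = F a s"
proof -
  have "(a, s) \<in> fraction A S a s"
    using equiv_class_self[OF equiv_frac_rel] assms(1,2) unfolding fraction_def by blast
  moreover have "F b t = F a s" if "(b, t) \<in> fraction A S a s" for b t
    using that assms(3) unfolding fraction_def frac_rel_def by blast
  ultimately show ?thesis by blast
qed

lemma frac_mult:
  assumes [simp]: "a \<in> carrier A" "b \<in> carrier A" "s \<in> S" "t \<in> S"
  shows "fraction A S a s \<otimes>\<^bsub>fractions A S\<^esub> fraction A S b t = fraction A S (a \<otimes> b) (s \<otimes> t)"
proof -
  have inner: "(\<Union>(y, r) \<in> fraction A S b t. fraction A S (x \<otimes> y) (q \<otimes> r)) = fraction A S (x \<otimes> b) (q \<otimes> t)"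
    if [simp]: "x \<in> carrier A" "q \<in> S" for x q
  proof (rule UN_frac)
    fix y r u assume [simp]: "y \<in> carrier A" "r \<in> S" "u \<in> S" and e: "b \<otimes> r \<otimes> u = y \<otimes> t \<otimes> u"
    have "x \<otimes> b \<otimes> (q \<otimes> r) \<otimes> u = (b \<otimes> r \<otimes> u) \<otimes> (x \<otimes> q)" by (simp add: m_ac)
    also have "\<dots> = x \<otimes> y \<otimes> (q \<otimes> t) \<otimes> u" unfolding e by (simp add: m_ac)
    finally show "fraction A S (x \<otimes> y) (q \<otimes> r) = fraction A S (x \<otimes> b) (q \<otimes> t)"
      by (subst frac_eq_iff) (auto simp: S_mult intro!: bexI[of _ u])
  qed simp_all
  have "(\<Union>(x, q) \<in> fraction A S a s. \<Union>(y, r) \<in> fraction A S b t. fraction A S (x \<otimes> y) (q \<otimes> r))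
      = (\<Union>(y, r) \<in> fraction A S b t. fraction A S (a \<otimes> y) (s \<otimes> r))"
  proof (rule UN_frac)
    fix x q u assume [simp]: "x \<in> carrier A" "q \<in> S" "u \<in> S" and e: "a \<otimes> q \<otimes> u = x \<otimes> s \<otimes> u"
    have "a \<otimes> b \<otimes> (q \<otimes> t) \<otimes> u = (a \<otimes> q \<otimes> u) \<otimes> (b \<otimes> t)" by (simp add: m_ac)
    also have "\<dots> = x \<otimes> b \<otimes> (s \<otimes> t) \<otimes> u" unfolding e by (simp add: m_ac)
    finally have "fraction A S (x \<otimes> b) (q \<otimes> t) = fraction A S (a \<otimes> b) (s \<otimes> t)"
      by (subst frac_eq_iff) (auto simp: S_mult intro!: bexI[of _ u])
    thus "(\<Union>(y, r) \<in> fraction A S b t. fraction A S (x \<otimes> y) (q \<otimes> r))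
        = (\<Union>(y, r) \<in> fraction A S b t. fraction A S (a \<otimes> y) (s \<otimes> r))"
      by (simp add: inner)
  qed simp_all
  thus ?thesis by (simp add: fractions_def inner)
qed

lemma frac_neg:
  assumes [simp]: "a \<in> carrier A" "s \<in> S"
  shows "\<ominus>\<^bsub>fractions A S\<^esub> fraction A S a s = fraction A S (\<ominus> a) s"
proof -
  have "(\<Union>(x, q) \<in> fraction A S a s. fraction A S (\<ominus> x) q) = fraction A S (\<ominus> a) s"
  proof (rule UN_frac)
    fix x q u assume [simp]: "x \<in> carrier A" "q \<in> S" "u \<in> S" and e: "a \<otimes> q \<otimes> u = x \<otimes> s \<otimes> u"
    show "fraction A S (\<ominus> x) q = fraction A S (\<ominus> a) s"
      by (subst frac_eq_iff) (auto simp: neg_closed neg_mult e intro!: bexI[of _ u])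
  qed simp_all
  thus ?thesis by (simp add: fractions_def)
qed

lemma frac_madd:
  assumes [simp]: "a \<in> carrier A" "b \<in> carrier A" "c \<in> carrier A" "s \<in> S" "t \<in> S" "u \<in> S"
  shows "fraction A S a s \<in> fraction A S b t \<oplus>\<^bsub>fractions A S\<^esub> fraction A S c u
    \<longleftrightarrow> (\<exists>v \<in> S. a \<otimes> t \<otimes> u \<otimes> v \<in> (b \<otimes> s \<otimes> u \<otimes> v) \<oplus> (c \<otimes> s \<otimes> t \<otimes> v))"
proof
  assume "\<exists>v \<in> S. a \<otimes> t \<otimes> u \<otimes> v \<in> (b \<otimes> s \<otimes> u \<otimes> v) \<oplus> (c \<otimes> s \<otimes> t \<otimes> v)"
  with assms show "fraction A S a s \<in> fraction A S b t \<oplus>\<^bsub>fractions A S\<^esub> fraction A S c u"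
    unfolding fractions_def multiring_struct.simps by blast
next
  assume "fraction A S a s \<in> fraction A S b t \<oplus>\<^bsub>fractions A S\<^esub> fraction A S c u"
  then obtain a' b' c' s' t' u' v where
    c' [simp]: "a' \<in> carrier A" "b' \<in> carrier A" "c' \<in> carrier A" "s' \<in> S" "t' \<in> S" "u' \<in> S" "v \<in> S"
    and eq: "fraction A S a s = fraction A S a' s'" "fraction A S b t = fraction A S b' t'"
      "fraction A S c u = fraction A S c' u'"
    and add: "a' \<otimes> t' \<otimes> u' \<otimes> v \<in> (b' \<otimes> s' \<otimes> u' \<otimes> v) \<oplus> (c' \<otimes> s' \<otimes> t' \<otimes> v)"
    unfolding fractions_def by auto
  obtain w1 w2 w3 where w [simp]: "w1 \<in> S" "w2 \<in> S" "w3 \<in> S"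
    and e: "a \<otimes> s' \<otimes> w1 = a' \<otimes> s \<otimes> w1" "b \<otimes> t' \<otimes> w2 = b' \<otimes> t \<otimes> w2"
      "c \<otimes> u' \<otimes> w3 = c' \<otimes> u \<otimes> w3"
    using eq frac_eq_iff by auto
  define d where "d = s \<otimes> t \<otimes> u \<otimes> w1 \<otimes> w2 \<otimes> w3"
  define z where "z = s' \<otimes> t' \<otimes> u' \<otimes> v \<otimes> w1 \<otimes> w2 \<otimes> w3"
  have z: "z \<in> S" unfolding z_def by (simp add: S_mult)
  have "a' \<otimes> t' \<otimes> u' \<otimes> v \<otimes> d \<in> (b' \<otimes> s' \<otimes> u' \<otimes> v \<otimes> d) \<oplus> (c' \<otimes> s' \<otimes> t' \<otimes> v \<otimes> d)"
    by (rule add_mult[OF _ _ _ _ add]) (simp_all add: d_def)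
  moreover have "a' \<otimes> t' \<otimes> u' \<otimes> v \<otimes> d = a \<otimes> t \<otimes> u \<otimes> z"
  proof -
    have "a' \<otimes> t' \<otimes> u' \<otimes> v \<otimes> d = (a' \<otimes> s \<otimes> w1) \<otimes> (t' \<otimes> u' \<otimes> v \<otimes> t \<otimes> u \<otimes> w2 \<otimes> w3)"
      unfolding d_def by (simp add: m_ac)
    also have "\<dots> = a \<otimes> t \<otimes> u \<otimes> z" unfolding e(1)[symmetric] z_def by (simp add: m_ac)
    finally show ?thesis .
  qed
  moreover have "b' \<otimes> s' \<otimes> u' \<otimes> v \<otimes> d = b \<otimes> s \<otimes> u \<otimes> z"
  proof -
    have "b' \<otimes> s' \<otimes> u' \<otimes> v \<otimes> d = (b' \<otimes> t \<otimes> w2) \<otimes> (s' \<otimes> u' \<otimes> v \<otimes> s \<otimes> u \<otimes> w1 \<otimes> w3)"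
      unfolding d_def by (simp add: m_ac)
    also have "\<dots> = b \<otimes> s \<otimes> u \<otimes> z" unfolding e(2)[symmetric] z_def by (simp add: m_ac)
    finally show ?thesis .
  qed
  moreover have "c' \<otimes> s' \<otimes> t' \<otimes> v \<otimes> d = c \<otimes> s \<otimes> t \<otimes> z"
  proof -
    have "c' \<otimes> s' \<otimes> t' \<otimes> v \<otimes> d = (c' \<otimes> u \<otimes> w3) \<otimes> (s' \<otimes> t' \<otimes> v \<otimes> s \<otimes> t \<otimes> w1 \<otimes> w2)"
      unfolding d_def by (simp add: m_ac)
    also have "\<dots> = c \<otimes> s \<otimes> t \<otimes> z" unfolding e(3)[symmetric] z_def by (simp add: m_ac)
    finally show ?thesis .
  qed
  ultimately show "\<exists>v \<in> S. a \<otimes> t \<otimes> u \<otimes> v \<in> (b \<otimes> s \<otimes> u \<otimes> v) \<oplus> (c \<otimes> s \<otimes> t \<otimes> v)"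
    using z by auto
qed

end

end

theory Submission
  imports Defs
begin

text \<open>
  Constructible sections. An identity between fractions, or the membership of one in a sum of two
  others, is expressed in \<open>K(p)\<close> by finitely many conditions \<open>v \<notin> p\<close> and \<open>i \<in> p\<close>
  (\<open>residue_add_iff\<close>). Such conditions are clopen in the constructible topology, so whatever holds
  between constructible sections at \<open>p\<close> holds near \<open>p\<close> (\<open>eventually_add\<close>). The constructible topology
  is compact (\<open>compact_spec\<close>) and has a base of clopen sets, so local solutions can be patched
  (\<open>section_patching\<close>). Consequently \<open>V(A)\<close> satisfies the axioms that all \<open>K(p)\<close> satisfy. The \<open>K(p)\<close>
  are fractions of quotients, and the conditions \<open>a\<^sup>3 = a\<close>, \<open>a + b\<^sup>2 a = {a}\<close> and uniqueness in
  \<open>a\<^sup>2 + b\<^sup>2\<close> pass to both. In their presence every sum of squares is idempotent, so semi-reality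
  reduces to \<open>1 \<noteq> 0\<close> (\<open>semireal_iff\<close>), and this holds in \<open>V(A)\<close> because \<open>A\<close> has a prime ideal and each
  \<open>K(p)\<close> is nontrivial.

  The quotient \<open>Q(A)\<close>. Sums and equality in \<open>Q(A)\<close> are defined through representatives, so the
  axioms transfer once two elements \<open>g\<close>, \<open>h\<close> of the same class can be related inside \<open>A\<close>. For a
  von Neumann hyperring this is possible with elements \<open>s\<close>, \<open>t\<close> on which all signs are \<open>1\<close> and which
  satisfy \<open>g s = h t\<close> (\<open>hat_eq_imp_multipliers\<close>). They are built explicitly from complements of
  supports: regularity and hyperdistributivity give, for each \<open>a\<close>, an \<open>f\<close> with \<open>a f = 0\<close> and
  \<open>1 \<in> a b + f\<close>. Multiplication by \<open>s\<close> and \<open>t\<close> does not change classes, and it makes different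
  representatives of one class equal, after which associativity and hyperdistributivity of \<open>A\<close> can
  be applied.
\<close>

section \<open>Elementary facts on multirings\<close>

context multiring
begin

declare zero_closed [simp] neg_closed [simp]

lemma add_carrier: "c \<in> a \<oplus> b \<Longrightarrow> a \<in> carrier A \<Longrightarrow> b \<in> carrier A \<Longrightarrow> c \<in> carrier A"
  using add_closed by blast

lemma zero_mult: "a \<in> carrier A \<Longrightarrow> \<zero> \<otimes> a = \<zero>"
  using m_comm[of \<zero> a] mult_zero by simp

lemma add_zero: "b \<in> carrier A \<Longrightarrow> b \<oplus> \<zero> = {b}"
  using add_zero_iff add_closed[of b \<zero>] by auto

lemma mult_annihilates_summand:
  assumes "c \<in> a \<oplus> b" "a \<in> carrier A" "b \<in> carrier A" "d \<in> carrier A" "b \<otimes> d = \<zero>"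
  shows "c \<otimes> d = a \<otimes> d"
  using add_mult[of c a b d] add_carrier[of c a b] add_zero[of "a \<otimes> d"] assms by auto

lemma neg_zero: "\<ominus> \<zero> = \<zero>"
  using zero_add_neg[of \<zero>] add_comm[of \<zero> "\<ominus> \<zero>"] add_zero[of "\<ominus> \<zero>"] by simp

end

section \<open>Sign homomorphisms\<close>

lemma three_simps:
  "carrier three = {- 1, 0, 1}" "x \<otimes>\<^bsub>three\<^esub> y = x * y" "\<one>\<^bsub>three\<^esub> = 1" "\<zero>\<^bsub>three\<^esub> = 0" "\<ominus>\<^bsub>three\<^esub> x = - x"
  "x \<oplus>\<^bsub>three\<^esub> y = (if x = 0 then {y} else if y = 0 then {x} else if x = y then {x} else {- 1, 0, 1})"
  by (simp_all add: three_def)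

lemma
  assumes "\<sigma> \<in> sper A"
  shows sper_values: "a \<in> carrier A \<Longrightarrow> \<sigma> a \<in> {- 1, 0, 1}"
    and sper_mult: "a \<in> carrier A \<Longrightarrow> b \<in> carrier A \<Longrightarrow> \<sigma> (a \<otimes>\<^bsub>A\<^esub> b) = \<sigma> a * \<sigma> b"
    and sper_zero: "\<sigma> \<zero>\<^bsub>A\<^esub> = 0"
    and sper_one: "\<sigma> \<one>\<^bsub>A\<^esub> = 1"
    and sper_add: "c \<in> a \<oplus>\<^bsub>A\<^esub> b \<Longrightarrow> a \<in> carrier A \<Longrightarrow> b \<in> carrier A \<Longrightarrow> c \<in> carrier A
      \<Longrightarrow> \<sigma> a = 0 \<or> \<sigma> b = 0 \<or> \<sigma> a = \<sigma> b \<Longrightarrow> \<sigma> c = (if \<sigma> a = 0 then \<sigma> b else \<sigma> a)"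
proof -
  have hom: "\<sigma> \<in> carrier A \<rightarrow>\<^sub>E carrier three"
    "\<forall>a \<in> carrier A. \<forall>b \<in> carrier A. \<forall>c \<in> carrier A.
      a \<in> b \<oplus>\<^bsub>A\<^esub> c \<longrightarrow> \<sigma> a \<in> \<sigma> b \<oplus>\<^bsub>three\<^esub> \<sigma> c"
    "\<forall>a \<in> carrier A. \<forall>b \<in> carrier A. \<sigma> (a \<otimes>\<^bsub>A\<^esub> b) = \<sigma> a \<otimes>\<^bsub>three\<^esub> \<sigma> b"
    "\<sigma> \<zero>\<^bsub>A\<^esub> = \<zero>\<^bsub>three\<^esub>" "\<sigma> \<one>\<^bsub>A\<^esub> = \<one>\<^bsub>three\<^esub>"
    using assms unfolding sper_def multiring_hom_def by blast+
  show "a \<in> carrier A \<Longrightarrow> \<sigma> a \<in> {- 1, 0, 1}" using hom(1) unfolding three_simps by blast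
  show "a \<in> carrier A \<Longrightarrow> b \<in> carrier A \<Longrightarrow> \<sigma> (a \<otimes>\<^bsub>A\<^esub> b) = \<sigma> a * \<sigma> b"
    using hom(3) unfolding three_simps by blast
  show "\<sigma> \<zero>\<^bsub>A\<^esub> = 0" "\<sigma> \<one>\<^bsub>A\<^esub> = 1" using hom(4,5) unfolding three_simps by blast+
  assume *: "c \<in> a \<oplus>\<^bsub>A\<^esub> b" "a \<in> carrier A" "b \<in> carrier A" "c \<in> carrier A"
    and signs: "\<sigma> a = 0 \<or> \<sigma> b = 0 \<or> \<sigma> a = \<sigma> b"
  have "\<sigma> c \<in> \<sigma> a \<oplus>\<^bsub>three\<^esub> \<sigma> b" using hom(2) * by blast
  thus "\<sigma> c = (if \<sigma> a = 0 then \<sigma> b else \<sigma> a)"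
    using signs unfolding three_simps by (auto simp del: insert_iff split: if_split_asm)
qed

lemma hat_eq_iff: "hat A a = hat A b \<longleftrightarrow> (\<forall>\<sigma> \<in> sper A. \<sigma> a = \<sigma> b)"
  unfolding hat_def by (auto simp: fun_eq_iff restrict_def)

lemma hat_one_mult:
  assumes "multiring A" "a \<in> carrier A" "s \<in> carrier A" "hat A s = hat A \<one>\<^bsub>A\<^esub>"
  shows "hat A (a \<otimes>\<^bsub>A\<^esub> s) = hat A a"
  using assms(2-) by (simp add: hat_eq_iff sper_mult sper_one)

section \<open>The real reduced quotient of a von Neumann hyperring\<close>

context von_neumann_hyperring
begin

text \<open>In a commutative von Neumann regular ring one would take \<open>f = 1 - a b\<close> with \<open>a = a\<^sup>2 b\<close>.
  Here \<open>1 - a b\<close> is a set; since \<open>0 \<in> a - a\<close> and \<open>a - a\<close> equals \<open>1 \<cdot> a + (- a b) \<cdot> a\<close>,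
  hyperdistributivity says exactly that some element of that set annihilates \<open>a\<close>.\<close>

lemma annihilator_complement:
  assumes [simp]: "a \<in> carrier A"
  shows "\<exists>b \<in> carrier A. \<exists>f \<in> carrier A. a \<otimes> f = \<zero> \<and> \<one> \<in> (a \<otimes> b) \<oplus> f"
proof -
  obtain b where b [simp]: "b \<in> carrier A" and "a [^] (2::nat) \<otimes> b = a"
    using regular[of a] by (metis assms)
  moreover have "(a \<otimes> b) \<otimes> a = a [^] (2::nat) \<otimes> b" by (simp add: numeral_2_eq_2 m_ac)
  ultimately have a: "(a \<otimes> b) \<otimes> a = a" by simp
  have "\<zero> \<in> a \<oplus> \<ominus> a" by (simp add: zero_add_neg)
  moreover have "\<one> \<otimes> a = a" "(\<ominus> (a \<otimes> b)) \<otimes> a = \<ominus> a" using a by (simp_all add: neg_mult)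
  ultimately have "\<zero> \<in> (\<one> \<otimes> a) \<oplus> ((\<ominus> (a \<otimes> b)) \<otimes> a)" by simp
  then obtain f where f: "f \<in> \<one> \<oplus> (\<ominus> (a \<otimes> b))" "\<zero> = f \<otimes> a"
    using hyperdistrib[of \<one> "\<ominus> (a \<otimes> b)" a \<zero>] by auto
  have fc: "f \<in> carrier A" using f(1) by (rule add_carrier) simp_all
  have "\<one> \<in> f \<oplus> (\<ominus> (\<ominus> (a \<otimes> b)))"
    using add_reverse[of f \<one> "\<ominus> (a \<otimes> b)"] f(1) fc by simp
  hence "\<one> \<in> (a \<otimes> b) \<oplus> f" using fc by (simp add: neg_neg add_comm)
  moreover have "a \<otimes> f = \<zero>" using f(2) fc by (simp add: m_comm)
  ultimately show ?thesis using b fc by blast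
qed

text \<open>The complement \<open>w\<close> satisfies \<open>1 \<in> a b + w\<close>, and every sign homomorphism kills the summand
  \<open>a b\<close>, so it must send \<open>w\<close> to \<open>1\<close>.\<close>

lemma annihilator_of_hat_zero:
  assumes [simp]: "a \<in> carrier A" and a: "\<forall>\<sigma> \<in> sper A. \<sigma> a = 0"
  shows "\<exists>w \<in> carrier A. a \<otimes> w = \<zero> \<and> (\<forall>\<sigma> \<in> sper A. \<sigma> w = 1)"
proof -
  obtain b w where [simp]: "b \<in> carrier A" "w \<in> carrier A"
    and w: "a \<otimes> w = \<zero>" "\<one> \<in> (a \<otimes> b) \<oplus> w"
    using annihilator_complement[of a] by auto
  have "\<sigma> w = 1" if s: "\<sigma> \<in> sper A" for \<sigma>
    using sper_add[OF s w(2)] sper_mult[OF s, of a b] sper_one[OF s] a s by simp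
  thus ?thesis using w by (intro bexI[of _ w]) simp_all
qed

text \<open>This is what replaces a Positivstellensatz: equality in the quotient is witnessed in \<open>A\<close> by
  multipliers that are positive everywhere. If \<open>g\<close> and \<open>h\<close> were units, \<open>s = h\<^sup>2\<close> and \<open>t = g h\<close>
  would do, because \<open>g h\<^sup>2 = h g h\<close> and \<open>g h\<close> has sign \<open>1\<close>. In general \<open>h\<^sup>2\<close> and \<open>g h\<close> are only
  positive on the support of \<open>g h\<close>, so one adds an element \<open>f\<close> that is \<open>1\<close> off the support and
  annihilates \<open>g h\<close>. Then \<open>g\<close> and \<open>h\<close> must be made to vanish where \<open>f\<close> lives: the products \<open>g f\<close>
  and \<open>h f\<close> have sign \<open>0\<close> everywhere but need not be \<open>0\<close>, and multiplying by the \<open>W\<close> below, of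
  sign \<open>1\<close>, kills them.\<close>

lemma hat_eq_imp_multipliers:
  assumes [simp]: "g \<in> carrier A" "h \<in> carrier A" and gh: "hat A g = hat A h"
  shows "\<exists>s \<in> carrier A. \<exists>t \<in> carrier A.
    hat A s = hat A \<one> \<and> hat A t = hat A \<one> \<and> g \<otimes> s = h \<otimes> t"
proof -
  have sgh: "\<sigma> g = \<sigma> h" if "\<sigma> \<in> sper A" for \<sigma> using gh that by (simp add: hat_eq_iff)
  obtain b f where [simp]: "b \<in> carrier A" "f \<in> carrier A"
    and f: "g \<otimes> h \<otimes> f = \<zero>" "\<one> \<in> (g \<otimes> h \<otimes> b) \<oplus> f"
    using annihilator_complement[of "g \<otimes> h"] by auto
  define e where "e = g \<otimes> h \<otimes> b"
  have [simp]: "e \<in> carrier A" by (simp add: e_def)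
  have fe: "f \<otimes> e = \<zero>"
  proof -
    have "f \<otimes> e = (g \<otimes> h \<otimes> f) \<otimes> b" by (simp add: e_def m_ac)
    thus ?thesis by (simp add: f zero_mult)
  qed
  have sf: "\<sigma> f = (if \<sigma> g = 0 then 1 else 0)" if s: "\<sigma> \<in> sper A" for \<sigma>
  proof -
    have "\<sigma> g * \<sigma> g * \<sigma> f = 0"
      using arg_cong[OF f(1), of \<sigma>] by (simp add: sper_mult[OF s] sper_zero[OF s] sgh[OF s])
    thus ?thesis using sper_add[OF s f(2)] sper_mult[OF s] sper_one[OF s] sgh[OF s] by auto
  qed
  have "\<forall>\<sigma> \<in> sper A. \<sigma> (g \<otimes> f) = 0" "\<forall>\<sigma> \<in> sper A. \<sigma> (h \<otimes> f) = 0"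
    by (simp_all add: sper_mult sf sgh)
  note ann = annihilator_of_hat_zero[OF _ this(1)] annihilator_of_hat_zero[OF _ this(2)]
  obtain w where [simp]: "w \<in> carrier A" and w: "(g \<otimes> f) \<otimes> w = \<zero>" "\<forall>\<sigma> \<in> sper A. \<sigma> w = 1"
    using ann(1) by auto
  obtain w' where [simp]: "w' \<in> carrier A" and w': "(h \<otimes> f) \<otimes> w' = \<zero>" "\<forall>\<sigma> \<in> sper A. \<sigma> w' = 1"
    using ann(2) by auto
  define W where "W = w \<otimes> w'"
  have [simp]: "W \<in> carrier A" by (simp add: W_def)
  \<comment> \<open>Multiplying \<open>1 \<in> e + f\<close> by an element annihilated by \<open>f\<close> shows that \<open>e\<close> acts on it as \<open>1\<close>.\<close>
  have f1: "(\<one> \<otimes> (x \<otimes> W)) = e \<otimes> (x \<otimes> W)"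
    if [simp]: "x \<in> carrier A" and x: "f \<otimes> (x \<otimes> W) = \<zero>" for x
    using mult_annihilates_summand[OF f(2) _ _ _ x] by (simp add: e_def)
  have "f \<otimes> (g \<otimes> W) = (g \<otimes> f \<otimes> w) \<otimes> w'" "f \<otimes> (h \<otimes> W) = (h \<otimes> f \<otimes> w') \<otimes> w"
    by (simp_all add: W_def m_ac)
  hence gW: "g \<otimes> W = e \<otimes> (g \<otimes> W)" and hW: "h \<otimes> W = e \<otimes> (h \<otimes> W)"
    using f1[of g] f1[of h] by (simp_all add: w w' zero_mult)
  \<comment> \<open>These sums are genuine sets; any element will do, as it is only used through its product
    with \<open>e\<close> and its signs.\<close>
  obtain s where s: "s \<in> (h \<otimes> h) \<oplus> f" and [simp]: "s \<in> carrier A"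
    using add_nonempty[of "h \<otimes> h" f] add_carrier[of _ "h \<otimes> h" f] by auto
  obtain t where t: "t \<in> (g \<otimes> h) \<oplus> f" and [simp]: "t \<in> carrier A"
    using add_nonempty[of "g \<otimes> h" f] add_carrier[of _ "g \<otimes> h" f] by auto
  have se: "s \<otimes> e = h \<otimes> h \<otimes> e" and te: "t \<otimes> e = g \<otimes> h \<otimes> e"
    using mult_annihilates_summand[OF s _ _ _ fe] mult_annihilates_summand[OF t _ _ _ fe] by simp_all
  have "\<sigma> (W \<otimes> s) = 1 \<and> \<sigma> (W \<otimes> t) = 1" if \<sigma>: "\<sigma> \<in> sper A" for \<sigma>
    using sper_add[OF \<sigma> s] sper_add[OF \<sigma> t] sper_values[OF \<sigma>, of h] \<sigma> w(2) w'(2)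
    by (auto simp: sper_mult sgh sf W_def)
  hence hats: "hat A (W \<otimes> s) = hat A \<one>" "hat A (W \<otimes> t) = hat A \<one>"
    by (simp_all add: hat_eq_iff sper_one)
  have "g \<otimes> (W \<otimes> s) = (g \<otimes> W) \<otimes> s" by (simp add: m_ac)
  also have "\<dots> = (g \<otimes> W) \<otimes> (s \<otimes> e)" by (subst gW) (simp add: m_ac)
  also have "\<dots> = (h \<otimes> W) \<otimes> (t \<otimes> e)" unfolding se te by (simp add: m_ac)
  also have "\<dots> = (h \<otimes> W) \<otimes> t" by (subst (2) hW) (simp add: m_ac)
  also have "\<dots> = h \<otimes> (W \<otimes> t)" by (simp add: m_ac)
  finally show ?thesis using hats by (intro bexI[of _ "W \<otimes> s"] bexI[of _ "W \<otimes> t"]) simp_all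
qed

lemma Q_simps:
  "carrier (multiring_Q A) = hat A ` carrier A"
  "\<one>\<^bsub>multiring_Q A\<^esub> = hat A \<one>" "\<zero>\<^bsub>multiring_Q A\<^esub> = hat A \<zero>"
  by (simp_all add: multiring_Q_def)

lemma Q_add_iff:
  "F \<in> G \<oplus>\<^bsub>multiring_Q A\<^esub> H \<longleftrightarrow> (\<exists>a \<in> carrier A. \<exists>b \<in> carrier A. \<exists>c \<in> carrier A.
     F = hat A a \<and> G = hat A b \<and> H = hat A c \<and> a \<in> b \<oplus> c)"
  by (simp add: multiring_Q_def)

lemma Q_addI:
  assumes "a \<in> b \<oplus> c" "b \<in> carrier A" "c \<in> carrier A"
  shows "hat A a \<in> hat A b \<oplus>\<^bsub>multiring_Q A\<^esub> hat A c"
  unfolding Q_add_iff using assms add_carrier by blast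

lemma Q_addE:
  assumes "F \<in> G \<oplus>\<^bsub>multiring_Q A\<^esub> H"
  obtains a b c where "a \<in> carrier A" "b \<in> carrier A" "c \<in> carrier A"
     "F = hat A a" "G = hat A b" "H = hat A c" "a \<in> b \<oplus> c"
  using assms unfolding Q_add_iff by blast

text \<open>Only associativity is not inherited at once. Its two hypotheses use two representatives
  \<open>g1\<close>, \<open>g2\<close> of the same class; multiplying them by \<open>s\<close> and \<open>t\<close> with \<open>g1 s = g2 t\<close> and both of
  sign \<open>1\<close> changes no class and makes the middle terms coincide, so that associativity of \<open>A\<close>
  applies.\<close>

lemma multiring_Q: "multiring (multiring_Q A)"
proof -
  have hm: "hat A a \<otimes>\<^bsub>multiring_Q A\<^esub> hat A b = hat A (a \<otimes> b)" if "a \<in> carrier A" "b \<in> carrier A" for a b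
    using that by (rule hat_mult)
  have hn: "\<ominus>\<^bsub>multiring_Q A\<^esub> hat A a = hat A (\<ominus> a)" if "a \<in> carrier A" for a
    using that by (rule hat_neg)
  show ?thesis
    unfolding multiring_def multiring_axioms_def
  proof (intro conjI allI impI)
    show "comm_monoid (multiring_Q A)"
      by (rule comm_monoidI) (auto simp: Q_simps hm m_ac)
  next
    fix a b assume "a \<in> carrier (multiring_Q A)" "b \<in> carrier (multiring_Q A)"
    then obtain x y where x: "a = hat A x" "b = hat A y" and [simp]: "x \<in> carrier A" "y \<in> carrier A"
      by (auto simp: Q_simps)
    show "a \<oplus>\<^bsub>multiring_Q A\<^esub> b \<noteq> {}"
      using add_nonempty[of x y] Q_addI[of _ x y] x by fastforce
    show "a \<oplus>\<^bsub>multiring_Q A\<^esub> b = b \<oplus>\<^bsub>multiring_Q A\<^esub> a"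
      using add_comm by (auto simp: Q_add_iff set_eq_iff) metis+
    show "a \<in> b \<oplus>\<^bsub>multiring_Q A\<^esub> \<zero>\<^bsub>multiring_Q A\<^esub> \<longleftrightarrow> a = b"
    proof
      assume "a \<in> b \<oplus>\<^bsub>multiring_Q A\<^esub> \<zero>\<^bsub>multiring_Q A\<^esub>"
      then obtain a' b' c' where *: "a' \<in> carrier A" "b' \<in> carrier A" "c' \<in> carrier A"
        "a = hat A a'" "b = hat A b'" "hat A \<zero> = hat A c'" "a' \<in> b' \<oplus> c'"
        unfolding Q_simps by (rule Q_addE)
      have "\<sigma> a' = \<sigma> b'" if "\<sigma> \<in> sper A" for \<sigma>
      proof -
        have "\<sigma> c' = 0" using *(6) that by (simp add: hat_eq_iff sper_zero)
        thus ?thesis using sper_add[OF that *(7)] * by auto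
      qed
      thus "a = b" using * by (simp add: hat_eq_iff)
    next
      assume "a = b"
      thus "a \<in> b \<oplus>\<^bsub>multiring_Q A\<^esub> \<zero>\<^bsub>multiring_Q A\<^esub>"
        using Q_addI[of y y \<zero>] x add_zero by (simp add: Q_simps)
    qed
  next
    fix a b c g x
    assume "a \<in> carrier (multiring_Q A)" "b \<in> carrier (multiring_Q A)" "c \<in> carrier (multiring_Q A)"
    assume "g \<in> a \<oplus>\<^bsub>multiring_Q A\<^esub> b" "x \<in> g \<oplus>\<^bsub>multiring_Q A\<^esub> c"
    then obtain a' b' g1 g2 c' x' where
      [simp]: "a' \<in> carrier A" "b' \<in> carrier A" "g1 \<in> carrier A" "g2 \<in> carrier A" "c' \<in> carrier A" "x' \<in> carrier A"
      and eq: "a = hat A a'" "b = hat A b'" "g = hat A g1" "g = hat A g2" "c = hat A c'" "x = hat A x'"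
      and in1: "g1 \<in> a' \<oplus> b'" and in2: "x' \<in> g2 \<oplus> c'"
      by (elim Q_addE) blast
    have "hat A g1 = hat A g2" using eq by simp
    then obtain s t where [simp]: "s \<in> carrier A" "t \<in> carrier A"
      and st: "hat A s = hat A \<one>" "hat A t = hat A \<one>" "g1 \<otimes> s = g2 \<otimes> t"
      using hat_eq_imp_multipliers[of g1 g2] by auto
    note hat = hat_one_mult[OF multiring_axioms]
    have "g1 \<otimes> s \<in> (a' \<otimes> s) \<oplus> (b' \<otimes> s)" "x' \<otimes> t \<in> (g1 \<otimes> s) \<oplus> (c' \<otimes> t)"
      unfolding st(3) using add_mult[OF _ _ _ _ in1, of s] add_mult[OF _ _ _ _ in2, of t] st(3) by simp_all
    then obtain h where h: "h \<in> (b' \<otimes> s) \<oplus> (c' \<otimes> t)" "x' \<otimes> t \<in> (a' \<otimes> s) \<oplus> h"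
      using add_assoc[of "a' \<otimes> s" "b' \<otimes> s" "c' \<otimes> t" "g1 \<otimes> s" "x' \<otimes> t"] by auto
    have [simp]: "h \<in> carrier A" using h(1) by (rule add_carrier) simp_all
    show "\<exists>h \<in> b \<oplus>\<^bsub>multiring_Q A\<^esub> c. x \<in> a \<oplus>\<^bsub>multiring_Q A\<^esub> h"
      using Q_addI[OF h(1)] Q_addI[OF h(2)] st by (auto simp: eq hat)
  next
    fix a b c assume "a \<in> b \<oplus>\<^bsub>multiring_Q A\<^esub> c"
    then obtain a' b' c' where *: "a' \<in> carrier A" "b' \<in> carrier A" "c' \<in> carrier A"
        "a = hat A a'" "b = hat A b'" "c = hat A c'" "a' \<in> b' \<oplus> c'" by (rule Q_addE)
    show "c \<in> (\<ominus>\<^bsub>multiring_Q A\<^esub> b) \<oplus>\<^bsub>multiring_Q A\<^esub> a"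
      "b \<in> a \<oplus>\<^bsub>multiring_Q A\<^esub> (\<ominus>\<^bsub>multiring_Q A\<^esub> c)"
      using * add_reverse[of a' b' c'] by (auto simp: hn intro!: Q_addI)
    fix d assume "d \<in> carrier (multiring_Q A)"
    thus "a \<otimes>\<^bsub>multiring_Q A\<^esub> d \<in> (b \<otimes>\<^bsub>multiring_Q A\<^esub> d) \<oplus>\<^bsub>multiring_Q A\<^esub> (c \<otimes>\<^bsub>multiring_Q A\<^esub> d)"
      using * by (auto simp: Q_simps hm intro!: Q_addI add_mult)
  qed (auto simp: Q_simps hm hn mult_zero elim!: Q_addE)
qed

text \<open>For hyperdistributivity the two summands are only represented by \<open>u\<close>, \<open>v\<close> of the same class
  as \<open>b d\<close>, \<open>c d\<close>. After multiplication by everywhere positive elements they become honest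
  multiples of \<open>d\<close>, and hyperdistributivity of \<open>A\<close> applies.\<close>

theorem von_neumann_hyperring_Q: "von_neumann_hyperring (multiring_Q A)"
proof -
  have hm: "hat A a \<otimes>\<^bsub>multiring_Q A\<^esub> hat A b = hat A (a \<otimes> b)" if "a \<in> carrier A" "b \<in> carrier A" for a b
    using that by (rule hat_mult)
  interpret Q: multiring "multiring_Q A" by (rule multiring_Q)
  show ?thesis
  proof unfold_locales
    fix b c d x
    assume "b \<in> carrier (multiring_Q A)" "c \<in> carrier (multiring_Q A)" "d \<in> carrier (multiring_Q A)"
    then obtain b' c' d' where [simp]: "b' \<in> carrier A" "c' \<in> carrier A" "d' \<in> carrier A"
      and eq: "b = hat A b'" "c = hat A c'" "d = hat A d'" by (auto simp: Q_simps)
    assume "x \<in> (b \<otimes>\<^bsub>multiring_Q A\<^esub> d) \<oplus>\<^bsub>multiring_Q A\<^esub> (c \<otimes>\<^bsub>multiring_Q A\<^esub> d)"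
    hence "x \<in> hat A (b' \<otimes> d') \<oplus>\<^bsub>multiring_Q A\<^esub> hat A (c' \<otimes> d')" by (simp add: eq hm)
    then obtain x' u v where [simp]: "x' \<in> carrier A" "u \<in> carrier A" "v \<in> carrier A" and x: "x = hat A x'"
      and uv: "hat A u = hat A (b' \<otimes> d')" "hat A v = hat A (c' \<otimes> d')" and xuv: "x' \<in> u \<oplus> v"
      by (elim Q_addE) simp
    obtain s t where [simp]: "s \<in> carrier A" "t \<in> carrier A"
      and st: "hat A s = hat A \<one>" "hat A t = hat A \<one>" "u \<otimes> s = b' \<otimes> d' \<otimes> t"
      using hat_eq_imp_multipliers[OF _ _ uv(1)] by auto
    obtain s' t' where [simp]: "s' \<in> carrier A" "t' \<in> carrier A"
      and st': "hat A s' = hat A \<one>" "hat A t' = hat A \<one>" "v \<otimes> s' = c' \<otimes> d' \<otimes> t'"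
      using hat_eq_imp_multipliers[OF _ _ uv(2)] by auto
    have "x' \<otimes> (s \<otimes> s') \<in> (u \<otimes> (s \<otimes> s')) \<oplus> (v \<otimes> (s \<otimes> s'))"
      by (rule add_mult) (simp_all add: xuv)
    also have "u \<otimes> (s \<otimes> s') = (u \<otimes> s) \<otimes> s'" by (simp add: m_ac)
    also have "\<dots> = (b' \<otimes> (t \<otimes> s')) \<otimes> d'" unfolding st(3) by (simp add: m_ac)
    also have "v \<otimes> (s \<otimes> s') = (v \<otimes> s') \<otimes> s" by (simp add: m_ac)
    also have "\<dots> = (c' \<otimes> (t' \<otimes> s)) \<otimes> d'" unfolding st'(3) by (simp add: m_ac)
    finally obtain a where a: "a \<in> (b' \<otimes> (t \<otimes> s')) \<oplus> (c' \<otimes> (t' \<otimes> s))" "x' \<otimes> (s \<otimes> s') = a \<otimes> d'"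
      using hyperdistrib[of "b' \<otimes> (t \<otimes> s')" "c' \<otimes> (t' \<otimes> s)" d'] by auto
    have [simp]: "a \<in> carrier A" using a(1) by (rule add_carrier) simp_all
    note hat = hat_one_mult[OF multiring_axioms]
    have "hat A (t \<otimes> s') = hat A \<one>" "hat A (t' \<otimes> s) = hat A \<one>" "hat A (s \<otimes> s') = hat A \<one>"
      using st st' by (simp_all add: hat)
    hence "hat A a \<in> b \<oplus>\<^bsub>multiring_Q A\<^esub> c" "x = hat A (a \<otimes> d')"
      using Q_addI[OF a(1)] a(2)[symmetric] by (simp_all add: hat eq x)
    thus "\<exists>a \<in> b \<oplus>\<^bsub>multiring_Q A\<^esub> c. x = a \<otimes>\<^bsub>multiring_Q A\<^esub> d"
      by (intro bexI[of _ "hat A a"]) (simp_all add: eq hm)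
  next
    fix a assume "a \<in> carrier (multiring_Q A)"
    then obtain x where [simp]: "x \<in> carrier A" and a: "a = hat A x" by (auto simp: Q_simps)
    obtain y where [simp]: "y \<in> carrier A" and y: "x = x [^] (2::nat) \<otimes> y"
      using regular[OF \<open>x \<in> carrier A\<close>] by blast
    have "hat A (x \<otimes> x \<otimes> y) = hat A x" using y[symmetric] by (simp add: numeral_2_eq_2)
    thus "\<exists>b \<in> carrier (multiring_Q A). a = a [^]\<^bsub>multiring_Q A\<^esub> (2::nat) \<otimes>\<^bsub>multiring_Q A\<^esub> b"
      by (intro bexI[of _ "hat A y"]) (simp_all add: a Q_simps hm numeral_2_eq_2)
  qed
qed

end

section \<open>Quotients and fractions\<close>

context multiring_ideal
begin

lemma quot_carrier: "carrier (quot A I) = quot_class A I ` carrier A"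
  unfolding quot_def quot_class_def by (auto simp: quotient_def)

lemma quot_one_zero: "\<one>\<^bsub>quot A I\<^esub> = quot_class A I \<one>" "\<zero>\<^bsub>quot A I\<^esub> = quot_class A I \<zero>"
  by (simp_all add: quot_def)

text \<open>The error term \<open>i\<close> in the definition of the sum of classes only changes the representative of
  the result. In this form all axioms transfer by choosing representatives.\<close>

lemma quot_add:
  assumes "b \<in> carrier A" "c \<in> carrier A"
  shows "quot_class A I b \<oplus>\<^bsub>quot A I\<^esub> quot_class A I c = quot_class A I ` (b \<oplus> c)"
proof (intro equalityI subsetI)
  fix X assume X: "X \<in> quot_class A I b \<oplus>\<^bsub>quot A I\<^esub> quot_class A I c"
  then obtain a where a: "a \<in> carrier A" "X = quot_class A I a" by (auto simp: quot_def)
  with X obtain i where "i \<in> I" "a \<in> (b \<oplus> c) \<uplus> {i}"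
    using quot_madd[OF a(1) assms] by blast
  then obtain d where d: "d \<in> b \<oplus> c" "a \<in> {d} \<uplus> I" unfolding set_madd_def by blast
  have "(a, d) \<in> quot_rel A I" using a d add_carrier[OF d(1) assms] by (simp add: quot_rel_iff)
  thus "X \<in> quot_class A I ` (b \<oplus> c)" using d(1) a(2) quot_class_cong by blast
next
  fix X assume "X \<in> quot_class A I ` (b \<oplus> c)"
  then obtain a where a: "a \<in> b \<oplus> c" "X = quot_class A I a" by blast
  have "a \<in> a \<oplus> \<zero>" using add_carrier[OF a(1) assms] by (simp add: add_zero)
  hence "a \<in> (b \<oplus> c) \<uplus> {\<zero>}" using a(1) unfolding set_madd_def by blast
  thus "X \<in> quot_class A I b \<oplus>\<^bsub>quot A I\<^esub> quot_class A I c"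
    using quot_madd[of a b c] a add_carrier[OF a(1) assms] assms ideal_zero by blast
qed

lemma multiring_quot: "multiring (quot A I)"
  unfolding multiring_def multiring_axioms_def
proof (intro conjI allI impI)
  show "comm_monoid (quot A I)"
    by (rule comm_monoidI) (auto simp: quot_carrier quot_mult quot_one_zero m_ac)
next
  fix A' B' C' G X
  assume "A' \<in> carrier (quot A I)" "B' \<in> carrier (quot A I)" "C' \<in> carrier (quot A I)"
  then obtain a b c where [simp]: "a \<in> carrier A" "b \<in> carrier A" "c \<in> carrier A"
    and eq: "A' = quot_class A I a" "B' = quot_class A I b" "C' = quot_class A I c"
    by (auto simp: quot_carrier)
  assume "G \<in> A' \<oplus>\<^bsub>quot A I\<^esub> B'"
  then obtain g where g: "g \<in> a \<oplus> b" "G = quot_class A I g" by (auto simp: eq quot_add)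
  have [simp]: "g \<in> carrier A" using g(1) by (rule add_carrier) simp_all
  assume "X \<in> G \<oplus>\<^bsub>quot A I\<^esub> C'"
  then obtain x where x: "x \<in> g \<oplus> c" "X = quot_class A I x" by (auto simp: eq g(2) quot_add)
  obtain h where h: "h \<in> b \<oplus> c" "x \<in> a \<oplus> h" using add_assoc[OF _ _ _ g(1) x(1)] by auto
  have "h \<in> carrier A" using h(1) by (rule add_carrier) simp_all
  thus "\<exists>h \<in> B' \<oplus>\<^bsub>quot A I\<^esub> C'. X \<in> A' \<oplus>\<^bsub>quot A I\<^esub> h"
    using h x by (intro bexI[of _ "quot_class A I h"]) (simp_all add: eq quot_add)
next
  fix A' B' C'
  assume "B' \<in> carrier (quot A I)" "C' \<in> carrier (quot A I)" "A' \<in> B' \<oplus>\<^bsub>quot A I\<^esub> C'"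
  then obtain a b c where [simp]: "b \<in> carrier A" "c \<in> carrier A" and a: "a \<in> b \<oplus> c"
    and eq: "A' = quot_class A I a" "B' = quot_class A I b" "C' = quot_class A I c"
    by (auto simp: quot_carrier quot_add)
  have [simp]: "a \<in> carrier A" using a by (rule add_carrier) simp_all
  show "C' \<in> (\<ominus>\<^bsub>quot A I\<^esub> B') \<oplus>\<^bsub>quot A I\<^esub> A'" "B' \<in> A' \<oplus>\<^bsub>quot A I\<^esub> (\<ominus>\<^bsub>quot A I\<^esub> C')"
    using add_reverse[OF _ _ _ a] by (simp_all add: eq quot_neg quot_add)
  fix D' assume "D' \<in> carrier (quot A I)"
  then obtain d where "d \<in> carrier A" "D' = quot_class A I d" by (auto simp: quot_carrier)
  thus "A' \<otimes>\<^bsub>quot A I\<^esub> D' \<in> (B' \<otimes>\<^bsub>quot A I\<^esub> D') \<oplus>\<^bsub>quot A I\<^esub> (C' \<otimes>\<^bsub>quot A I\<^esub> D')"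
    using add_mult[OF _ _ _ _ a] by (simp add: eq quot_mult quot_add)
qed (auto simp: quot_carrier quot_one_zero quot_neg quot_add quot_mult add_zero mult_zero
      add_nonempty add_comm intro!: imageI intro: add_carrier)

end

context multiring_fractions
begin

lemma fraction_closed: "a \<in> carrier A \<Longrightarrow> s \<in> S \<Longrightarrow> fraction A S a s \<in> carrier (fractions A S)"
  unfolding fractions_def fraction_def by (auto simp: quotient_def)

lemma fractions_cases:
  assumes "X \<in> carrier (fractions A S)"
  obtains a s where "a \<in> carrier A" "s \<in> S" "X = fraction A S a s"
  using assms unfolding fractions_def fraction_def by (auto simp: quotient_def)

lemma fractions_one_zero:
  "\<one>\<^bsub>fractions A S\<^esub> = fraction A S \<one> \<one>" "\<zero>\<^bsub>fractions A S\<^esub> = fraction A S \<zero> \<one>"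
  by (simp_all add: fractions_def)

lemma fraction_cancel:
  assumes [simp]: "a \<in> carrier A" "s \<in> S" "r \<in> S"
  shows "fraction A S (a \<otimes> r) (s \<otimes> r) = fraction A S a s"
proof -
  have "a \<otimes> r \<otimes> s \<otimes> \<one> = a \<otimes> (s \<otimes> r) \<otimes> \<one>" by (simp add: m_ac)
  thus ?thesis using S_one S_mult by (subst frac_eq_iff) auto
qed

text \<open>Over a common denominator the cross-multiplication and the cancellation factor in the definition
  of the sum disappear, and the axioms can be transferred from the numerators.\<close>

lemma fraction_addI:
  assumes a: "a \<in> b \<oplus> c" and [simp]: "b \<in> carrier A" "c \<in> carrier A" "s \<in> S"
  shows "fraction A S a s \<in> fraction A S b s \<oplus>\<^bsub>fractions A S\<^esub> fraction A S c s"
proof -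
  have [simp]: "a \<in> carrier A" using a by (rule add_carrier) simp_all
  have "a \<otimes> (s \<otimes> s \<otimes> \<one>) \<in> (b \<otimes> (s \<otimes> s \<otimes> \<one>)) \<oplus> (c \<otimes> (s \<otimes> s \<otimes> \<one>))"
    by (rule add_mult[OF _ _ _ _ a]) simp_all
  thus ?thesis using S_one by (subst frac_madd) (auto simp: m_assoc intro!: bexI[of _ \<one>])
qed

lemma fraction_addE:
  assumes "X \<in> Y \<oplus>\<^bsub>fractions A S\<^esub> Z"
  obtains a b c s where "a \<in> b \<oplus> c" "a \<in> carrier A" "b \<in> carrier A" "c \<in> carrier A" "s \<in> S"
    "X = fraction A S a s" "Y = fraction A S b s" "Z = fraction A S c s"
proof -
  obtain a b c s t u v where [simp]: "a \<in> carrier A" "b \<in> carrier A" "c \<in> carrier A" "s \<in> S" "t \<in> S"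
      "u \<in> S" "v \<in> S"
    and eq: "X = fraction A S a s" "Y = fraction A S b t" "Z = fraction A S c u"
    and add: "a \<otimes> t \<otimes> u \<otimes> v \<in> (b \<otimes> s \<otimes> u \<otimes> v) \<oplus> (c \<otimes> s \<otimes> t \<otimes> v)"
    using assms unfolding fractions_def by auto
  have "a \<otimes> t \<otimes> u \<otimes> v = a \<otimes> (t \<otimes> u \<otimes> v)" "b \<otimes> s \<otimes> u \<otimes> v = b \<otimes> (s \<otimes> u \<otimes> v)"
    "c \<otimes> s \<otimes> t \<otimes> v = c \<otimes> (s \<otimes> t \<otimes> v)" "s \<otimes> t \<otimes> u \<otimes> v = s \<otimes> (t \<otimes> u \<otimes> v)"
    "t \<otimes> (s \<otimes> u \<otimes> v) = s \<otimes> (t \<otimes> u \<otimes> v)" "u \<otimes> (s \<otimes> t \<otimes> v) = s \<otimes> (t \<otimes> u \<otimes> v)"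
    by (simp_all add: m_ac)
  moreover have "fraction A S (a \<otimes> (t \<otimes> u \<otimes> v)) (s \<otimes> (t \<otimes> u \<otimes> v)) = X"
    "fraction A S (b \<otimes> (s \<otimes> u \<otimes> v)) (t \<otimes> (s \<otimes> u \<otimes> v)) = Y"
    "fraction A S (c \<otimes> (s \<otimes> t \<otimes> v)) (u \<otimes> (s \<otimes> t \<otimes> v)) = Z"
    unfolding eq by (rule fraction_cancel; simp add: S_mult)+
  ultimately show ?thesis
    using add by (intro that[of "a \<otimes> (t \<otimes> u \<otimes> v)" "b \<otimes> (s \<otimes> u \<otimes> v)" "c \<otimes> (s \<otimes> t \<otimes> v)"
          "s \<otimes> (t \<otimes> u \<otimes> v)"]) (simp_all add: S_mult)
qed

text \<open>The common denominators of the two given sums may differ, so \<open>G\<close> appears as \<open>g/s\<close> and as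
  \<open>g'/t\<close>; over the denominator \<open>s t w\<close>, where \<open>g t w = g' s w\<close>, the numerators agree.\<close>

lemma fraction_add_assoc:
  assumes G: "G \<in> Y \<oplus>\<^bsub>fractions A S\<^esub> Z" and X: "X \<in> G \<oplus>\<^bsub>fractions A S\<^esub> W"
  shows "\<exists>H \<in> Z \<oplus>\<^bsub>fractions A S\<^esub> W. X \<in> Y \<oplus>\<^bsub>fractions A S\<^esub> H"
proof -
  obtain g a b s where add1: "g \<in> a \<oplus> b"
    and [simp]: "g \<in> carrier A" "a \<in> carrier A" "b \<in> carrier A" "s \<in> S"
    and eq1: "G = fraction A S g s" "Y = fraction A S a s" "Z = fraction A S b s"
    using G by (rule fraction_addE)
  obtain x g' c t where add2: "x \<in> g' \<oplus> c"
    and [simp]: "x \<in> carrier A" "g' \<in> carrier A" "c \<in> carrier A" "t \<in> S"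
    and eq2: "X = fraction A S x t" "G = fraction A S g' t" "W = fraction A S c t"
    using X by (rule fraction_addE)
  obtain w where [simp]: "w \<in> S" and w: "g \<otimes> t \<otimes> w = g' \<otimes> s \<otimes> w"
    using eq1(1) eq2(2) frac_eq_iff[of g g' s t] by auto
  have [simp]: "s \<otimes> w \<in> S" "t \<otimes> w \<in> S" "s \<otimes> (t \<otimes> w) \<in> S" by (simp_all add: S_mult)
  have "g \<otimes> (t \<otimes> w) \<in> (a \<otimes> (t \<otimes> w)) \<oplus> (b \<otimes> (t \<otimes> w))"
    by (rule add_mult[OF _ _ _ _ add1]) simp_all
  moreover have "x \<otimes> (s \<otimes> w) \<in> (g' \<otimes> (s \<otimes> w)) \<oplus> (c \<otimes> (s \<otimes> w))"
    by (rule add_mult[OF _ _ _ _ add2]) simp_all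
  moreover have "g' \<otimes> (s \<otimes> w) = g \<otimes> (t \<otimes> w)" using w by (simp add: m_assoc)
  ultimately obtain h where h: "h \<in> (b \<otimes> (t \<otimes> w)) \<oplus> (c \<otimes> (s \<otimes> w))"
      "x \<otimes> (s \<otimes> w) \<in> (a \<otimes> (t \<otimes> w)) \<oplus> h"
    using add_assoc[of "a \<otimes> (t \<otimes> w)" "b \<otimes> (t \<otimes> w)" "c \<otimes> (s \<otimes> w)" "g \<otimes> (t \<otimes> w)"
        "x \<otimes> (s \<otimes> w)"] by auto
  have [simp]: "h \<in> carrier A" using h(1) by (rule add_carrier) simp_all
  have *: "s \<otimes> (t \<otimes> w) = t \<otimes> (s \<otimes> w)" by (simp add: m_ac)
  have "fraction A S (a \<otimes> (t \<otimes> w)) (s \<otimes> (t \<otimes> w)) = Y"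
    "fraction A S (b \<otimes> (t \<otimes> w)) (s \<otimes> (t \<otimes> w)) = Z"
    "fraction A S (c \<otimes> (s \<otimes> w)) (s \<otimes> (t \<otimes> w)) = W"
    "fraction A S (x \<otimes> (s \<otimes> w)) (s \<otimes> (t \<otimes> w)) = X"
    unfolding eq1(2,3) eq2 using fraction_cancel[of _ s "t \<otimes> w"] fraction_cancel[of _ t "s \<otimes> w"]
    by (simp_all add: *)
  thus ?thesis
    using fraction_addI[OF h(1), of "s \<otimes> (t \<otimes> w)"] fraction_addI[OF h(2), of "s \<otimes> (t \<otimes> w)"] by auto
qed

lemma multiring_fractions: "multiring (fractions A S)"
  unfolding multiring_def multiring_axioms_def
proof (intro conjI allI impI)
  show "comm_monoid (fractions A S)"
    using S_one by (intro comm_monoidI)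
      (auto simp: frac_mult fractions_one_zero S_mult m_ac intro!: fraction_closed elim!: fractions_cases)
next
  fix Y Z assume "Y \<in> carrier (fractions A S)" "Z \<in> carrier (fractions A S)"
  then obtain b c t u where [simp]: "b \<in> carrier A" "c \<in> carrier A" "t \<in> S" "u \<in> S"
    and eq: "Y = fraction A S b t" "Z = fraction A S c u" by (auto elim!: fractions_cases)
  have "fraction A S (b \<otimes> u) (t \<otimes> u) = Y" "fraction A S (c \<otimes> t) (t \<otimes> u) = Z"
    using fraction_cancel[of b t u] fraction_cancel[of c u t] m_comm[of t u] by (simp_all add: eq)
  moreover obtain a where "a \<in> (b \<otimes> u) \<oplus> (c \<otimes> t)" using add_nonempty[of "b \<otimes> u" "c \<otimes> t"] by auto
  ultimately show "Y \<oplus>\<^bsub>fractions A S\<^esub> Z \<noteq> {}"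
    using fraction_addI[of a "b \<otimes> u" "c \<otimes> t" "t \<otimes> u"] by (auto simp: S_mult)
next
  show "Y \<oplus>\<^bsub>fractions A S\<^esub> Z = Z \<oplus>\<^bsub>fractions A S\<^esub> Y" for Y Z
  proof -
    have "Y \<oplus>\<^bsub>fractions A S\<^esub> Z \<subseteq> Z \<oplus>\<^bsub>fractions A S\<^esub> Y" for Y Z
    proof
      fix X assume "X \<in> Y \<oplus>\<^bsub>fractions A S\<^esub> Z"
      thus "X \<in> Z \<oplus>\<^bsub>fractions A S\<^esub> Y"
        by (rule fraction_addE) (auto simp: add_comm intro!: fraction_addI)
    qed
    thus ?thesis by blast
  qed
next
  fix X Y assume X: "X \<in> carrier (fractions A S)"
  show "X \<in> Y \<oplus>\<^bsub>fractions A S\<^esub> \<zero>\<^bsub>fractions A S\<^esub> \<longleftrightarrow> X = Y"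
  proof
    assume "X \<in> Y \<oplus>\<^bsub>fractions A S\<^esub> \<zero>\<^bsub>fractions A S\<^esub>"
    then obtain a b c s where add: "a \<in> b \<oplus> c"
      and [simp]: "a \<in> carrier A" "b \<in> carrier A" "c \<in> carrier A" "s \<in> S"
      and eq: "X = fraction A S a s" "Y = fraction A S b s" "fraction A S \<zero> \<one> = fraction A S c s"
      unfolding fractions_one_zero by (rule fraction_addE)
    obtain u where u [simp]: "u \<in> S" "c \<otimes> u = \<zero>"
      using eq(3) frac_eq_iff[of \<zero> c \<one> s] S_one by (auto simp: zero_mult)
    have "a \<otimes> u = b \<otimes> u" using add by (rule mult_annihilates_summand) simp_all
    hence "a \<otimes> s \<otimes> u = b \<otimes> s \<otimes> u" by (metis m_assoc m_comm \<open>a \<in> carrier A\<close> \<open>b \<in> carrier A\<close> \<open>s \<in> S\<close> S_carrier u(1))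
    thus "X = Y" unfolding eq by (subst frac_eq_iff) auto
  next
    assume "X = Y"
    then obtain a s where [simp]: "a \<in> carrier A" "s \<in> S" and eq: "X = fraction A S a s" "Y = fraction A S a s"
      using X by (auto elim!: fractions_cases)
    have "fraction A S \<zero> s = fraction A S \<zero> \<one>" using S_one by (subst frac_eq_iff) (auto simp: zero_mult)
    thus "X \<in> Y \<oplus>\<^bsub>fractions A S\<^esub> \<zero>\<^bsub>fractions A S\<^esub>"
      using fraction_addI[of a a \<zero> s] by (simp add: add_zero eq fractions_one_zero)
  qed
next
  fix X Y Z assume "X \<in> Y \<oplus>\<^bsub>fractions A S\<^esub> Z"
  then obtain a b c s where add: "a \<in> b \<oplus> c"
    and [simp]: "a \<in> carrier A" "b \<in> carrier A" "c \<in> carrier A" "s \<in> S"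
    and eq: "X = fraction A S a s" "Y = fraction A S b s" "Z = fraction A S c s"
    by (rule fraction_addE)
  show "Z \<in> (\<ominus>\<^bsub>fractions A S\<^esub> Y) \<oplus>\<^bsub>fractions A S\<^esub> X" "Y \<in> X \<oplus>\<^bsub>fractions A S\<^esub> (\<ominus>\<^bsub>fractions A S\<^esub> Z)"
    using add_reverse[OF _ _ _ add] by (auto simp: eq frac_neg intro!: fraction_addI)
  fix W assume "W \<in> carrier (fractions A S)"
  then obtain d t where "d \<in> carrier A" "t \<in> S" "W = fraction A S d t" by (auto elim!: fractions_cases)
  thus "X \<otimes>\<^bsub>fractions A S\<^esub> W \<in> (Y \<otimes>\<^bsub>fractions A S\<^esub> W) \<oplus>\<^bsub>fractions A S\<^esub> (Z \<otimes>\<^bsub>fractions A S\<^esub> W)"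
    using add_mult[OF _ _ _ _ add] by (auto simp: eq frac_mult S_mult intro!: fraction_addI)
next
  fix X assume "X \<in> carrier (fractions A S)"
  then obtain d t where [simp]: "d \<in> carrier A" "t \<in> S" and "X = fraction A S d t" by (auto elim!: fractions_cases)
  moreover have "fraction A S \<zero> t = fraction A S \<zero> \<one>" using S_one by (subst frac_eq_iff) (auto simp: zero_mult)
  ultimately show "X \<otimes>\<^bsub>fractions A S\<^esub> \<zero>\<^bsub>fractions A S\<^esub> = \<zero>\<^bsub>fractions A S\<^esub>"
    using S_one by (simp add: fractions_one_zero frac_mult mult_zero)
qed (use S_one in \<open>auto simp: fractions_one_zero frac_neg
      intro!: fraction_closed intro: fraction_add_assoc elim!: fractions_cases elim: fraction_addE\<close>)

end

section \<open>Reduced multirings\<close>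

text \<open>The axioms of a real reduced multiring other than semi-reality. They pass to quotients,
  fractions and multirings of sections, while semi-reality amounts to \<open>1 \<noteq> 0\<close> in their presence.\<close>

locale reduced_multiring = multiring +
  assumes mult_cube: "a \<in> carrier A \<Longrightarrow> a \<otimes> (a \<otimes> a) = a"
    and add_mult_square: "a \<in> carrier A \<Longrightarrow> b \<in> carrier A \<Longrightarrow> a \<oplus> (b \<otimes> b \<otimes> a) = {a}"
    and add_squares_unique: "a \<in> carrier A \<Longrightarrow> b \<in> carrier A \<Longrightarrow>
      x \<in> (a \<otimes> a) \<oplus> (b \<otimes> b) \<Longrightarrow> y \<in> (a \<otimes> a) \<oplus> (b \<otimes> b) \<Longrightarrow> x = y"

lemma real_reduced_iff: "real_reduced_multiring A \<longleftrightarrow> reduced_multiring A \<and> semireal A"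
proof
  assume "real_reduced_multiring A"
  then interpret real_reduced_multiring A .
  have "reduced_multiring A"
  proof unfold_locales
    show "a \<otimes>\<^bsub>A\<^esub> (a \<otimes>\<^bsub>A\<^esub> a) = a" if "a \<in> carrier A" for a
      using cube[OF that] that by (simp add: numeral_3_eq_3 m_ac)
    show "a \<oplus>\<^bsub>A\<^esub> (b \<otimes>\<^bsub>A\<^esub> b \<otimes>\<^bsub>A\<^esub> a) = {a}" if "a \<in> carrier A" "b \<in> carrier A" for a b
      using add_square_mult[OF that] that by (simp add: numeral_2_eq_2)
    show "x = y" if "a \<in> carrier A" "b \<in> carrier A"
      "x \<in> (a \<otimes>\<^bsub>A\<^esub> a) \<oplus>\<^bsub>A\<^esub> (b \<otimes>\<^bsub>A\<^esub> b)" "y \<in> (a \<otimes>\<^bsub>A\<^esub> a) \<oplus>\<^bsub>A\<^esub> (b \<otimes>\<^bsub>A\<^esub> b)" for a b x y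
      using square_add_square[OF that(1,2)] that by (auto simp: numeral_2_eq_2)
  qed
  thus "reduced_multiring A \<and> semireal A" using semireal by blast
next
  assume *: "reduced_multiring A \<and> semireal A"
  then interpret reduced_multiring A by blast
  show "real_reduced_multiring A"
  proof unfold_locales
    show "semireal A" using * by blast
    show "a [^]\<^bsub>A\<^esub> (3::nat) = a" if "a \<in> carrier A" for a
      using mult_cube[OF that] that by (simp add: numeral_3_eq_3 m_ac)
    show "a \<oplus>\<^bsub>A\<^esub> (b [^]\<^bsub>A\<^esub> (2::nat) \<otimes>\<^bsub>A\<^esub> a) = {a}" if "a \<in> carrier A" "b \<in> carrier A" for a b
      using add_mult_square[OF that] that by (simp add: numeral_2_eq_2)
    show "\<exists>!x. x \<in> a [^]\<^bsub>A\<^esub> (2::nat) \<oplus>\<^bsub>A\<^esub> b [^]\<^bsub>A\<^esub> (2::nat)"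
      if "a \<in> carrier A" "b \<in> carrier A" for a b
      using add_squares_unique[OF that] add_nonempty[of "a \<otimes>\<^bsub>A\<^esub> a" "b \<otimes>\<^bsub>A\<^esub> b"] that
      by (auto simp: numeral_2_eq_2)
  qed
qed

context reduced_multiring
begin

lemma double: "a \<in> carrier A \<Longrightarrow> a \<oplus> a = {a}"
  using add_mult_square[of a \<one>] by simp

text \<open>By \<open>a + b\<^sup>2 a = {a}\<close>, an element \<open>x \<in> a + b\<close> satisfies \<open>x a = a\<close> and \<open>x b = b\<close>; hence \<open>x\<^sup>2\<close>
  also lies in \<open>a + b\<close>, which is a singleton because \<open>a\<close> and \<open>b\<close> are squares.\<close>

lemma sum_of_idempotents:
  assumes x: "x \<in> a \<oplus> b" and [simp]: "a \<in> carrier A" "b \<in> carrier A"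
    and ab: "a \<otimes> a = a" "b \<otimes> b = b"
  shows "x \<otimes> x = x"
proof -
  have [simp]: "x \<in> carrier A" using x by (rule add_carrier) simp_all
  have "x \<otimes> a \<in> a \<oplus> (b \<otimes> b \<otimes> a)" "x \<otimes> b \<in> (a \<otimes> a \<otimes> b) \<oplus> b"
    using add_mult[OF _ _ _ _ x, of a] add_mult[OF _ _ _ _ x, of b] by (simp_all add: ab)
  moreover have "(a \<otimes> a \<otimes> b) \<oplus> b = b \<oplus> (a \<otimes> a \<otimes> b)" by (rule add_comm) simp_all
  ultimately have "x \<otimes> a = a" "x \<otimes> b = b" using add_mult_square by auto
  hence "x \<otimes> x \<in> a \<oplus> b" using add_mult[OF _ _ _ _ x, of x] by (simp add: m_comm)
  thus ?thesis using add_squares_unique[of a b "x \<otimes> x" x] x by (simp add: ab)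
qed

lemma sums_of_squares_idempotent:
  assumes "x \<in> sums_of_squares A"
  shows "x \<in> carrier A \<and> x \<otimes> x = x"
proof -
  have "list_madd A (map (\<lambda>x. x [^] (2::nat)) xs) \<subseteq> {x \<in> carrier A. x \<otimes> x = x}"
    if "xs \<noteq> []" "set xs \<subseteq> carrier A" for xs
    using that
  proof (induction xs rule: induct_list012)
    case (2 a)
    thus ?case using mult_cube[of a] by (auto simp: numeral_2_eq_2 m_ac)
  next
    case (3 a b xs)
    have a: "a [^] (2::nat) \<in> carrier A" "a [^] (2::nat) \<otimes> a [^] (2::nat) = a [^] (2::nat)"
      using 3 mult_cube[of a] by (auto simp: numeral_2_eq_2 m_ac)
    show ?case
    proof
      fix x assume "x \<in> list_madd A (map (\<lambda>x. x [^] (2::nat)) (a # b # xs))"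
      then obtain y where y: "y \<in> list_madd A (map (\<lambda>x. x [^] (2::nat)) (b # xs))"
        and x: "x \<in> a [^] (2::nat) \<oplus> y" by (auto simp: set_madd_def)
      have "y \<in> carrier A" "y \<otimes> y = y" using y 3 by auto
      thus "x \<in> {x \<in> carrier A. x \<otimes> x = x}"
        using sum_of_idempotents[OF x] add_carrier[OF x] a by simp
    qed
  qed simp
  thus ?thesis using assms unfolding sums_of_squares_def by blast
qed

text \<open>If \<open>-1\<close> is a sum of squares, it is idempotent, so \<open>-1 = (-1)\<^sup>2 = 1\<close>; and then \<open>0 \<in> 1 + 1 = {1}\<close>.
  Conversely, \<open>1 = 0\<close> gives \<open>-1 = 1 = 1\<^sup>2\<close>.\<close>

lemma semireal_iff: "semireal A \<longleftrightarrow> \<one> \<noteq> \<zero>"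
proof -
  have "\<one> \<in> sums_of_squares A"
    unfolding sums_of_squares_def by (rule UN_I[of "[\<one>]"]) simp_all
  moreover have "\<ominus> \<one> = \<one>" if "\<ominus> \<one> \<in> sums_of_squares A"
  proof -
    have "(\<ominus> \<one>) \<otimes> (\<ominus> \<one>) = \<one>" by (simp add: neg_mult neg_neg)
    thus ?thesis using sums_of_squares_idempotent[OF that] by simp
  qed
  moreover have "\<one> = \<zero>" if "\<ominus> \<one> = \<one>" using zero_add_neg[of \<one>] double[of \<one>] that by simp
  moreover have "\<ominus> \<one> = \<one>" if "\<one> = \<zero>" using neg_zero that by simp
  ultimately show ?thesis unfolding semireal_def by metis
qed


lemma reduced_quot:
  assumes "mideal A I"
  shows "reduced_multiring (quot A I)"
proof -
  interpret multiring_ideal A I using assms by unfold_locales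
  interpret Q: multiring "quot A I" by (rule multiring_quot)
  show ?thesis
  proof unfold_locales
    show "X \<otimes>\<^bsub>quot A I\<^esub> (X \<otimes>\<^bsub>quot A I\<^esub> X) = X" if "X \<in> carrier (quot A I)" for X
      using that by (auto simp: quot_carrier quot_mult mult_cube)
    show "X \<oplus>\<^bsub>quot A I\<^esub> (Y \<otimes>\<^bsub>quot A I\<^esub> Y \<otimes>\<^bsub>quot A I\<^esub> X) = {X}"
      if "X \<in> carrier (quot A I)" "Y \<in> carrier (quot A I)" for X Y
      using that by (auto simp: quot_carrier quot_mult quot_add add_mult_square)
    fix X Y U V
    assume "X \<in> carrier (quot A I)" "Y \<in> carrier (quot A I)"
      "U \<in> (X \<otimes>\<^bsub>quot A I\<^esub> X) \<oplus>\<^bsub>quot A I\<^esub> (Y \<otimes>\<^bsub>quot A I\<^esub> Y)"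
      "V \<in> (X \<otimes>\<^bsub>quot A I\<^esub> X) \<oplus>\<^bsub>quot A I\<^esub> (Y \<otimes>\<^bsub>quot A I\<^esub> Y)"
    then obtain a b u v where "a \<in> carrier A" "b \<in> carrier A"
      "u \<in> (a \<otimes> a) \<oplus> (b \<otimes> b)" "v \<in> (a \<otimes> a) \<oplus> (b \<otimes> b)" "U = quot_class A I u" "V = quot_class A I v"
      by (auto simp: quot_carrier quot_mult quot_add)
    thus "U = V" using add_squares_unique[of a b u v] by simp
  qed
qed

text \<open>Since \<open>s\<^sup>3 = s\<close>, one has \<open>a/s = a s/1\<close>: every fraction has denominator \<open>1\<close>, and the axioms
  can be checked on numerators up to a common factor \<open>v \<in> S\<close>.\<close>

lemma reduced_fractions:
  assumes "multiring_fractions A S"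
  shows "reduced_multiring (fractions A S)"
proof -
  interpret multiring_fractions A S by fact
  note [simp] = S_one
  have integral: "\<exists>x \<in> carrier A. X = fraction A S x \<one>" if X: "X \<in> carrier (fractions A S)" for X
  proof -
    obtain a s where [simp]: "a \<in> carrier A" "s \<in> S" and eq: "X = fraction A S a s"
      using X by (rule fractions_cases)
    have "a \<otimes> \<one> \<otimes> s = a \<otimes> s \<otimes> s \<otimes> s"
      using mult_cube[of s] by (simp add: m_assoc)
    hence "X = fraction A S (a \<otimes> s) \<one>" unfolding eq by (subst frac_eq_iff) auto
    thus ?thesis by auto
  qed
  have add: "fraction A S a \<one> \<in> fraction A S b \<one> \<oplus>\<^bsub>fractions A S\<^esub> fraction A S c \<one>
      \<longleftrightarrow> (\<exists>v \<in> S. a \<otimes> v \<in> (b \<otimes> v) \<oplus> (c \<otimes> v))"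
    if "a \<in> carrier A" "b \<in> carrier A" "c \<in> carrier A" for a b c
    using that by (simp add: frac_madd)
  have eq: "fraction A S a \<one> = fraction A S b \<one>"
    if "a \<in> carrier A" "b \<in> carrier A" "v \<in> S" "a \<otimes> v = b \<otimes> v" for a b v
    using that by (subst frac_eq_iff) auto
  interpret F: multiring "fractions A S" by (rule multiring_fractions)
  show ?thesis
  proof unfold_locales
    show "X \<otimes>\<^bsub>fractions A S\<^esub> (X \<otimes>\<^bsub>fractions A S\<^esub> X) = X" if "X \<in> carrier (fractions A S)" for X
      using integral[OF that] by (auto simp: frac_mult mult_cube)
    show "X \<oplus>\<^bsub>fractions A S\<^esub> (Y \<otimes>\<^bsub>fractions A S\<^esub> Y \<otimes>\<^bsub>fractions A S\<^esub> X) = {X}"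
      if XY: "X \<in> carrier (fractions A S)" "Y \<in> carrier (fractions A S)" for X Y
    proof -
      obtain a b where [simp]: "a \<in> carrier A" "b \<in> carrier A"
        and X: "X = fraction A S a \<one>" "Y = fraction A S b \<one>"
        using integral[OF XY(1)] integral[OF XY(2)] by auto
      have "Z = X" if Z: "Z \<in> X \<oplus>\<^bsub>fractions A S\<^esub> (Y \<otimes>\<^bsub>fractions A S\<^esub> Y \<otimes>\<^bsub>fractions A S\<^esub> X)" for Z
      proof -
        have "Z \<in> carrier (fractions A S)" using Z XY by (auto dest: F.add_carrier)
        then obtain c where [simp]: "c \<in> carrier A" and c: "Z = fraction A S c \<one>" using integral by blast
        obtain v where [simp]: "v \<in> S" and v: "c \<otimes> v \<in> (a \<otimes> v) \<oplus> (b \<otimes> b \<otimes> a \<otimes> v)"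
          using Z by (auto simp: X c frac_mult add)
        have "b \<otimes> b \<otimes> a \<otimes> v = b \<otimes> b \<otimes> (a \<otimes> v)" by (simp add: m_assoc)
        hence "c \<otimes> v = a \<otimes> v" using v add_mult_square[of "a \<otimes> v" b] by simp
        thus "Z = X" unfolding X c by (intro eq[of _ _ v]) simp_all
      qed
      moreover have "X \<oplus>\<^bsub>fractions A S\<^esub> (Y \<otimes>\<^bsub>fractions A S\<^esub> Y \<otimes>\<^bsub>fractions A S\<^esub> X) \<noteq> {}"
        using XY by (intro F.add_nonempty) simp_all
      ultimately show ?thesis by blast
    qed
    fix X Y U V
    assume XY: "X \<in> carrier (fractions A S)" "Y \<in> carrier (fractions A S)"
    then obtain a b where [simp]: "a \<in> carrier A" "b \<in> carrier A"
      and X: "X = fraction A S a \<one>" "Y = fraction A S b \<one>"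
      using integral[OF XY(1)] integral[OF XY(2)] by auto
    obtain c where c: "c \<in> (a \<otimes> a) \<oplus> (b \<otimes> b)"
      using add_nonempty[of "a \<otimes> a" "b \<otimes> b"] by auto
    have [simp]: "c \<in> carrier A" using c by (rule add_carrier) simp_all
    have "Z = fraction A S c \<one>"
      if Z: "Z \<in> (X \<otimes>\<^bsub>fractions A S\<^esub> X) \<oplus>\<^bsub>fractions A S\<^esub> (Y \<otimes>\<^bsub>fractions A S\<^esub> Y)" for Z
    proof -
      have "Z \<in> carrier (fractions A S)" using Z XY by (auto dest: F.add_carrier)
      then obtain d where [simp]: "d \<in> carrier A" and d: "Z = fraction A S d \<one>" using integral by blast
      obtain v where [simp]: "v \<in> S" and v: "d \<otimes> v \<in> (a \<otimes> a \<otimes> v) \<oplus> (b \<otimes> b \<otimes> v)"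
        using Z by (auto simp: X d frac_mult add)
      have sq: "x \<otimes> x \<otimes> v \<otimes> v = (x \<otimes> v) \<otimes> (x \<otimes> v)"
        "x \<otimes> x \<otimes> (v \<otimes> v) = (x \<otimes> v) \<otimes> (x \<otimes> v)" if "x \<in> carrier A" for x
        using that by (simp_all add: m_ac)
      have "d \<otimes> v \<otimes> v \<in> (a \<otimes> v) \<otimes> (a \<otimes> v) \<oplus> (b \<otimes> v) \<otimes> (b \<otimes> v)"
        using add_mult[OF _ _ _ _ v, of v] by (simp add: sq)
      moreover have "c \<otimes> (v \<otimes> v) \<in> (a \<otimes> v) \<otimes> (a \<otimes> v) \<oplus> (b \<otimes> v) \<otimes> (b \<otimes> v)"
        using add_mult[OF _ _ _ _ c, of "v \<otimes> v"] by (simp add: sq)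
      ultimately have "d \<otimes> (v \<otimes> v) = c \<otimes> (v \<otimes> v)"
        using add_squares_unique[of "a \<otimes> v" "b \<otimes> v"] by (simp add: m_assoc)
      thus ?thesis unfolding d by (intro eq[of _ _ "v \<otimes> v"]) (simp_all add: S_mult)
    qed
    moreover assume "U \<in> (X \<otimes>\<^bsub>fractions A S\<^esub> X) \<oplus>\<^bsub>fractions A S\<^esub> (Y \<otimes>\<^bsub>fractions A S\<^esub> Y)"
      "V \<in> (X \<otimes>\<^bsub>fractions A S\<^esub> X) \<oplus>\<^bsub>fractions A S\<^esub> (Y \<otimes>\<^bsub>fractions A S\<^esub> Y)"
    ultimately show "U = V" by metis
  qed
qed

end

section \<open>Prime ideals and residue multifields\<close>

context multiring
begin

lemma mideal_spec: "p \<in> spec A \<Longrightarrow> mideal A p"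
  by (simp add: spec_def prime_mideal_def)

lemma prime_mult:
  "\<lbrakk>p \<in> spec A; a \<in> carrier A; b \<in> carrier A; a \<notin> p; b \<notin> p\<rbrakk> \<Longrightarrow> a \<otimes> b \<notin> p"
  unfolding spec_def prime_mideal_def by blast

lemma one_notin_prime: "p \<in> spec A \<Longrightarrow> \<one> \<notin> p"
  by (simp add: spec_def prime_mideal_def)

text \<open>An ideal \<open>M\<close> maximal among those not containing \<open>1\<close> is prime: if \<open>b \<notin> M\<close>, then
  \<open>I = {x. x b \<in> M}\<close> is an ideal containing \<open>M\<close> but not \<open>1\<close>, so \<open>I = M\<close>. Using the colon ideal avoids
  describing the ideal generated by \<open>M\<close> and \<open>a\<close>, whose elements are arbitrarily long multivalued sums.\<close>

lemma spec_nonempty: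
  assumes "\<one> \<noteq> \<zero>"
  shows "spec A \<noteq> {}"
proof -
  define \<I> where "\<I> = {I. mideal A I \<and> \<one> \<notin> I}"
  have "{\<zero>} \<in> \<I>"
    using assms by (auto simp: \<I>_def mideal_def set_madd_def add_zero mult_zero)
  have "\<Union>C \<in> \<I>" if "C \<noteq> {}" and C: "subset.chain \<I> C" for C
  proof -
    have 1: "\<And>I. I \<in> C \<Longrightarrow> mideal A I \<and> \<one> \<notin> I" using C by (auto simp: subset.chain_def \<I>_def)
    have "x \<oplus> y \<subseteq> \<Union>C" if IJ: "I \<in> C" "x \<in> I" "J \<in> C" "y \<in> J" for x y I J
    proof -
      have "I \<subseteq> J \<or> J \<subseteq> I" using C IJ by (auto simp: subset.chain_def)
      then obtain K where "K \<in> C" "x \<in> K" "y \<in> K" using IJ by blast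
      thus ?thesis using 1[of K] unfolding mideal_def set_madd_def by blast
    qed
    hence "(\<Union>C) \<uplus> (\<Union>C) \<subseteq> \<Union>C" unfolding set_madd_def by blast
    moreover have "\<Union>C \<noteq> {}" "\<Union>C \<subseteq> carrier A" "\<forall>a \<in> carrier A. \<forall>i \<in> \<Union>C. a \<otimes> i \<in> \<Union>C" "\<one> \<notin> \<Union>C"
      using 1 \<open>C \<noteq> {}\<close> unfolding mideal_def by blast+
    ultimately show ?thesis unfolding \<I>_def mideal_def by blast
  qed
  with \<open>{\<zero>} \<in> \<I>\<close> obtain M where M: "M \<in> \<I>" and max: "\<And>I. I \<in> \<I> \<Longrightarrow> M \<subseteq> I \<Longrightarrow> I = M"
    using subset_Zorn_nonempty[of \<I>] by blast
  interpret multiring_ideal A M using M by unfold_locales (simp add: \<I>_def)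
  have "a \<in> M" if ab: "a \<in> carrier A" "b \<in> carrier A" "a \<otimes> b \<in> M" "b \<notin> M" for a b
  proof -
    define I where "I = {x \<in> carrier A. x \<otimes> b \<in> M}"
    have MI: "M \<subseteq> I" using ideal_mult[of b] m_comm[of _ b] ideal_subset ab(2) unfolding I_def by auto
    have "x \<oplus> y \<subseteq> I" if "x \<in> I" "y \<in> I" for x y
    proof
      fix z assume z: "z \<in> x \<oplus> y"
      have xy: "x \<in> carrier A" "y \<in> carrier A" "x \<otimes> b \<in> M" "y \<otimes> b \<in> M" using that by (auto simp: I_def)
      have "z \<in> carrier A" using z xy(1,2) by (rule add_carrier)
      moreover have "z \<otimes> b \<in> M"
        using add_mult[OF calculation xy(1,2) ab(2) z] xy(3,4) ideal_add unfolding set_madd_def by blast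
      ultimately show "z \<in> I" by (simp add: I_def)
    qed
    hence "I \<uplus> I \<subseteq> I" unfolding set_madd_def by blast
    moreover have "x \<otimes> i \<in> I" if "x \<in> carrier A" "i \<in> I" for x i
      using that ideal_mult[of x "i \<otimes> b"] ab(2) by (simp add: I_def m_assoc)
    moreover have "I \<noteq> {}" "I \<subseteq> carrier A" "\<one> \<notin> I"
      using MI ideal_nonempty ab by (auto simp: I_def)
    ultimately have "I \<in> \<I>" unfolding \<I>_def mideal_def by blast
    hence "I = M" using max MI by blast
    moreover have "a \<in> I" using ab by (simp add: I_def)
    ultimately show "a \<in> M" by simp
  qed
  hence "prime_mideal A M" using M unfolding prime_mideal_def \<I>_def by blast
  thus ?thesis unfolding spec_def by blast
qed

end

locale multiring_prime = multiring +
  fixes p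
  assumes prime: "p \<in> spec A"
begin

sublocale multiring_ideal A p
  by unfold_locales (rule mideal_spec[OF prime])

sublocale quot: multiring "quot A p"
  by (rule multiring_quot)

lemma nonzero_class_iff:
  assumes "a \<in> carrier A"
  shows "quot_class A p a \<in> nonzero_classes A p \<longleftrightarrow> a \<notin> p"
proof -
  have "quot_class A p a = quot_class A p \<zero> \<longleftrightarrow> a \<in> p"
    using quot_class_eq_iff[of a \<zero>] assms by (simp add: neg_zero add_zero)
  thus ?thesis using assms by (auto simp: nonzero_classes_def quot_carrier quot_one_zero)
qed

lemma nonzero_classes_cases:
  assumes "X \<in> nonzero_classes A p"
  obtains a where "a \<in> carrier A" "a \<notin> p" "X = quot_class A p a"
  using assms nonzero_class_iff unfolding nonzero_classes_def quot_carrier by blast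

sublocale residue: multiring_fractions "quot A p" "nonzero_classes A p"
proof unfold_locales
  show "nonzero_classes A p \<subseteq> carrier (quot A p)" by (auto simp: nonzero_classes_def)
  show "\<one>\<^bsub>quot A p\<^esub> \<in> nonzero_classes A p"
    using one_notin_prime[OF prime] by (simp add: quot_one_zero nonzero_class_iff)
  show "X \<otimes>\<^bsub>quot A p\<^esub> Y \<in> nonzero_classes A p"
    if "X \<in> nonzero_classes A p" "Y \<in> nonzero_classes A p" for X Y
    using that prime_mult[OF prime] by (auto elim!: nonzero_classes_cases simp: quot_mult nonzero_class_iff)
qed

lemma multiring_residue: "multiring (residue_multifield A p)"
  unfolding residue_multifield_def by (rule residue.multiring_fractions)

lemma class_closed: "a \<in> carrier A \<Longrightarrow> quot_class A p a \<in> carrier (quot A p)"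
  by (simp add: quot_carrier)

lemma residue_closed:
  "x \<in> carrier A \<Longrightarrow> y \<in> carrier A \<Longrightarrow> y \<notin> p \<Longrightarrow> residue_fraction A p x y \<in> carrier (residue_multifield A p)"
  unfolding residue_fraction_def residue_multifield_def
  by (intro residue.fraction_closed) (simp_all add: class_closed nonzero_class_iff)

lemma residue_cases:
  assumes "X \<in> carrier (residue_multifield A p)"
  obtains x y where "x \<in> carrier A" "y \<in> carrier A" "y \<notin> p" "X = residue_fraction A p x y"
proof -
  obtain a s where "a \<in> carrier (quot A p)" "s \<in> nonzero_classes A p"
    "X = fraction (quot A p) (nonzero_classes A p) a s"
    using assms unfolding residue_multifield_def by (rule residue.fractions_cases)
  thus ?thesis
    using that unfolding residue_fraction_def quot_carrier by (elim nonzero_classes_cases) blast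
qed

lemma residue_mult:
  assumes "x \<in> carrier A" "y \<in> carrier A" "y \<notin> p" "z \<in> carrier A" "w \<in> carrier A" "w \<notin> p"
  shows "residue_fraction A p x y \<otimes>\<^bsub>residue_multifield A p\<^esub> residue_fraction A p z w
    = residue_fraction A p (x \<otimes> z) (y \<otimes> w)"
  using assms unfolding residue_fraction_def residue_multifield_def
  by (simp add: residue.frac_mult class_closed nonzero_class_iff quot_mult)

lemma residue_neg:
  assumes "x \<in> carrier A" "y \<in> carrier A" "y \<notin> p"
  shows "\<ominus>\<^bsub>residue_multifield A p\<^esub> residue_fraction A p x y = residue_fraction A p (\<ominus> x) y"
  using assms unfolding residue_fraction_def residue_multifield_def
  by (simp add: residue.frac_neg class_closed nonzero_class_iff quot_neg)

lemma residue_one_zero: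
  "\<one>\<^bsub>residue_multifield A p\<^esub> = residue_fraction A p \<one> \<one>"
  "\<zero>\<^bsub>residue_multifield A p\<^esub> = residue_fraction A p \<zero> \<one>"
  unfolding residue_fraction_def residue_multifield_def
  by (simp_all add: residue.fractions_one_zero quot_one_zero)

lemma residue_one_neq_zero: "\<one>\<^bsub>residue_multifield A p\<^esub> \<noteq> \<zero>\<^bsub>residue_multifield A p\<^esub>"
proof
  assume "\<one>\<^bsub>residue_multifield A p\<^esub> = \<zero>\<^bsub>residue_multifield A p\<^esub>"
  then obtain U where "U \<in> nonzero_classes A p" "U = \<zero>\<^bsub>quot A p\<^esub>"
    unfolding residue_multifield_def residue.fractions_one_zero
    by (subst (asm) residue.frac_eq_iff) (auto simp: residue.S_one quot.zero_mult)
  thus False by (simp add: nonzero_classes_def)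
qed

text \<open>Membership in a sum of residue classes is witnessed by one element outside \<open>p\<close> and one
  inside \<open>p\<close>. Both conditions are clopen in \<open>p\<close>, which makes the relation persist near \<open>p\<close>.\<close>

lemma residue_add_iff:
  assumes "x \<in> carrier A" "y \<in> carrier A" "z \<in> carrier A"
    "s \<in> carrier A" "t \<in> carrier A" "u \<in> carrier A" "s \<notin> p" "t \<notin> p" "u \<notin> p"
  shows "residue_fraction A p x s \<in>
      residue_fraction A p y t \<oplus>\<^bsub>residue_multifield A p\<^esub> residue_fraction A p z u
    \<longleftrightarrow> (\<exists>v \<in> carrier A. v \<notin> p \<and>
      (\<exists>i \<in> p. x \<otimes> t \<otimes> u \<otimes> v \<in> ((y \<otimes> s \<otimes> u \<otimes> v) \<oplus> (z \<otimes> s \<otimes> t \<otimes> v)) \<uplus> {i}))"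
    (is "?L \<longleftrightarrow> (\<exists>v \<in> carrier A. v \<notin> p \<and> ?R v)")
proof -
  have "?L \<longleftrightarrow> (\<exists>V \<in> nonzero_classes A p.
      quot_class A p (x \<otimes> t \<otimes> u) \<otimes>\<^bsub>quot A p\<^esub> V \<in>
      (quot_class A p (y \<otimes> s \<otimes> u) \<otimes>\<^bsub>quot A p\<^esub> V) \<oplus>\<^bsub>quot A p\<^esub>
      (quot_class A p (z \<otimes> s \<otimes> t) \<otimes>\<^bsub>quot A p\<^esub> V))"
    using assms unfolding residue_fraction_def residue_multifield_def
    by (simp add: residue.frac_madd class_closed nonzero_class_iff quot_mult)
  also have "\<dots> \<longleftrightarrow> (\<exists>v \<in> carrier A. v \<notin> p \<and>
      quot_class A p (x \<otimes> t \<otimes> u) \<otimes>\<^bsub>quot A p\<^esub> quot_class A p v \<in>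
      (quot_class A p (y \<otimes> s \<otimes> u) \<otimes>\<^bsub>quot A p\<^esub> quot_class A p v) \<oplus>\<^bsub>quot A p\<^esub>
      (quot_class A p (z \<otimes> s \<otimes> t) \<otimes>\<^bsub>quot A p\<^esub> quot_class A p v))"
    using nonzero_class_iff by (metis nonzero_classes_cases)
  also have "\<dots> \<longleftrightarrow> (\<exists>v \<in> carrier A. v \<notin> p \<and> ?R v)"
    using assms by (intro bex_cong refl conj_cong) (simp add: quot_mult quot_madd)
  finally show ?thesis .
qed

end

lemma (in reduced_multiring) reduced_residue:
  assumes "p \<in> spec A"
  shows "reduced_multiring (residue_multifield A p)"
proof -
  interpret multiring_prime A p using assms by unfold_locales
  interpret Q: reduced_multiring "quot A p" by (rule reduced_quot[OF mideal])
  show ?thesis unfolding residue_multifield_def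
    by (rule Q.reduced_fractions) (rule residue.multiring_fractions_axioms)
qed

section \<open>The constructible topology\<close>

text \<open>The filter generated by the clopen neighbourhoods of \<open>p\<close>. It turns local statements about
  sections into \<^const>\<open>eventually\<close> statements, so that common neighbourhoods need not be named.\<close>

definition near :: "('a, 'm) multiring_struct_scheme \<Rightarrow> 'a set \<Rightarrow> 'a set filter" where
  "near A p = (INF U \<in> {U. openin (constructible_topology A) U \<and>
     closedin (constructible_topology A) U \<and> p \<in> U}. principal U)"

context multiring
begin

lemma topspace_spec: "topspace (constructible_topology A) = spec A"
  by (rule topspace_constructible_topology) simp

lemma clopen_basic:
  assumes "a \<in> carrier A"
  shows "openin (constructible_topology A) (basic_open A a)"
    and "closedin (constructible_topology A) (basic_open A a)"
proof -
  have "openin (constructible_topology A) (basic_open A a)"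
    "openin (constructible_topology A) (spec A - basic_open A a)"
    using assms unfolding constructible_topology_def by (auto intro!: topology_generated_by_Basis)
  thus "openin (constructible_topology A) (basic_open A a)"
    and "closedin (constructible_topology A) (basic_open A a)"
    by (auto simp: closedin_def topspace_spec basic_open_def)
qed

lemma eventually_near_iff:
  assumes "p \<in> spec A"
  shows "eventually P (near A p) \<longleftrightarrow> (\<exists>U. openin (constructible_topology A) U \<and>
    closedin (constructible_topology A) U \<and> p \<in> U \<and> (\<forall>q \<in> U. P q))"
proof -
  define \<U> where "\<U> = {U. openin (constructible_topology A) U \<and>
     closedin (constructible_topology A) U \<and> p \<in> U}"
  have "spec A \<in> \<U>"
    using assms openin_topspace[of "constructible_topology A"] closedin_topspace[of "constructible_topology A"]
    by (simp add: \<U>_def topspace_spec)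
  moreover have "\<exists>W \<in> \<U>. principal W \<le> inf (principal U) (principal V)" if "U \<in> \<U>" "V \<in> \<U>" for U V
    using that by (intro bexI[of _ "U \<inter> V"]) (auto simp: \<U>_def)
  ultimately have "eventually P (INF U \<in> \<U>. principal U) \<longleftrightarrow> (\<exists>U \<in> \<U>. eventually P (principal U))"
    by (intro eventually_INF_base) auto
  thus ?thesis by (auto simp: near_def \<U>_def eventually_principal)
qed

lemma eventually_near_self: "p \<in> spec A \<Longrightarrow> eventually P (near A p) \<Longrightarrow> P p"
  by (auto simp: eventually_near_iff)

lemma eventually_near_clopen:
  assumes p: "p \<in> spec A" and U: "openin (constructible_topology A) U" "closedin (constructible_topology A) U"
  shows "eventually (\<lambda>q. q \<in> U \<longleftrightarrow> p \<in> U) (near A p)"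
proof (cases "p \<in> U")
  case True
  thus ?thesis unfolding eventually_near_iff[OF p] using U by blast
next
  case False
  have "openin (constructible_topology A) (spec A - U)" "closedin (constructible_topology A) (spec A - U)"
    using U openin_closedin_eq[of "constructible_topology A" U]
    by (auto simp: closedin_def topspace_spec)
  thus ?thesis unfolding eventually_near_iff[OF p] using False p by (intro exI[of _ "spec A - U"]) auto
qed

lemma eventually_near_spec:
  assumes "p \<in> spec A"
  shows "eventually (\<lambda>q. q \<in> spec A) (near A p)"
  using eventually_near_clopen[OF assms openin_topspace closedin_topspace] assms by (simp add: topspace_spec)

lemma eventually_near_mem:
  assumes "p \<in> spec A" "a \<in> carrier A"
  shows "eventually (\<lambda>q. a \<in> q \<longleftrightarrow> a \<in> p) (near A p)"
  using eventually_near_clopen[OF assms(1) clopen_basic[OF assms(2)]] eventually_near_spec[OF assms(1)]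
  by eventually_elim (use assms in \<open>auto simp: basic_open_def\<close>)

text \<open>Identifying a subset of \<open>A\<close> with its characteristic function, the prime ideals form a subset
  \<open>Z\<close> of the compact space \<open>{False, True}\<^sup>A\<close>. Each instance of a prime ideal axiom involves
  finitely many elements of \<open>A\<close>, hence defines a clopen set, so \<open>Z\<close> is closed; and \<open>Z\<close> maps
  continuously onto the spectrum.\<close>

theorem compact_spec: "compact_space (constructible_topology A)"
proof -
  let ?X = "product_topology (\<lambda>a. discrete_topology (UNIV :: bool set)) (carrier A)"
  let ?\<psi> = "\<lambda>\<chi>. {a \<in> carrier A. \<chi> a}"
  define Z where "Z = {\<chi> \<in> topspace ?X. ?\<psi> \<chi> \<in> spec A}"
  have coord: "openin ?X {\<chi> \<in> topspace ?X. \<chi> a \<in> S}" "closedin ?X {\<chi> \<in> topspace ?X. \<chi> a \<in> S}"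
    if "a \<in> carrier A" for a S
  proof -
    have "continuous_map ?X (discrete_topology UNIV) (\<lambda>\<chi>. \<chi> a)"
      using that by (rule continuous_map_product_projection)
    from openin_continuous_map_preimage[OF this, of S] closedin_continuous_map_preimage[OF this, of S]
    show "openin ?X {\<chi> \<in> topspace ?X. \<chi> a \<in> S}" "closedin ?X {\<chi> \<in> topspace ?X. \<chi> a \<in> S}"
      by simp_all
  qed
  have Zt: "topspace (subtopology ?X Z) = Z" using Z_def by auto
  have ZS: "openin (subtopology ?X Z) (Z \<inter> {\<chi> \<in> topspace ?X. \<chi> a \<in> S})" if "a \<in> carrier A" for a S
    using coord(1)[OF that] by (rule openin_subtopology_Int2)
  have Z_mem: "\<chi> \<in> topspace ?X" "?\<psi> \<chi> \<in> spec A"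
    "a \<in> carrier A \<Longrightarrow> ?\<psi> \<chi> \<in> basic_open A a \<longleftrightarrow> \<not> \<chi> a" if "\<chi> \<in> Z" for \<chi> a
    using that unfolding Z_def basic_open_def by simp_all
  \<comment> \<open>All axioms except those on the two constants are instances of this one implication, with some of
    the four elements equal.\<close>
  have closed_imp: "closedin ?X {\<chi> \<in> topspace ?X. \<chi> a \<and> \<chi> b \<longrightarrow> \<chi> c \<or> \<chi> d}"
    if "a \<in> carrier A" "b \<in> carrier A" "c \<in> carrier A" "d \<in> carrier A" for a b c d
  proof -
    have "{\<chi> \<in> T. \<chi> a \<and> \<chi> b \<longrightarrow> \<chi> c \<or> \<chi> d} =
      ({\<chi> \<in> T. \<chi> a \<in> {False}} \<union> {\<chi> \<in> T. \<chi> b \<in> {False}}) \<union>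
      ({\<chi> \<in> T. \<chi> c \<in> {True}} \<union> {\<chi> \<in> T. \<chi> d \<in> {True}})" for T :: "('a \<Rightarrow> bool) set"
      by auto
    thus ?thesis using that by (simp only:) (intro closedin_Un coord(2))
  qed
  have "Z = {\<chi> \<in> topspace ?X. \<chi> \<zero> \<in> {True}} \<inter> {\<chi> \<in> topspace ?X. \<chi> \<one> \<in> {False}} \<inter>
    (\<Inter>a \<in> carrier A. \<Inter>b \<in> carrier A. \<Inter>c \<in> a \<oplus> b.
      {\<chi> \<in> topspace ?X. \<chi> a \<and> \<chi> b \<longrightarrow> \<chi> c \<or> \<chi> c}) \<inter>
    (\<Inter>a \<in> carrier A. \<Inter>b \<in> carrier A. {\<chi> \<in> topspace ?X. \<chi> b \<and> \<chi> b \<longrightarrow> \<chi> (a \<otimes> b) \<or> \<chi> (a \<otimes> b)}) \<inter>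
    (\<Inter>a \<in> carrier A. \<Inter>b \<in> carrier A. {\<chi> \<in> topspace ?X. \<chi> (a \<otimes> b) \<and> \<chi> (a \<otimes> b) \<longrightarrow> \<chi> a \<or> \<chi> b})"
    (is "Z = ?Z")
  proof (intro equalityI subsetI)
    fix \<chi> assume "\<chi> \<in> Z"
    hence \<chi>: "\<chi> \<in> topspace ?X" and p: "?\<psi> \<chi> \<in> spec A" by (auto simp: Z_def)
    interpret multiring_ideal A "?\<psi> \<chi>" using mideal_spec[OF p] by unfold_locales
    have "\<chi> c" if "a \<in> carrier A" "b \<in> carrier A" "c \<in> a \<oplus> b" "\<chi> a" "\<chi> b" for a b c
      using ideal_add that unfolding set_madd_def by blast
    moreover have "\<chi> (a \<otimes> b)" if "a \<in> carrier A" "b \<in> carrier A" "\<chi> b" for a b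
      using ideal_mult[of a b] that by blast
    moreover have "\<chi> a \<or> \<chi> b" if "a \<in> carrier A" "b \<in> carrier A" "\<chi> (a \<otimes> b)" for a b
      using prime_mult[OF p that(1,2)] that by auto
    moreover have "\<chi> \<zero>" "\<not> \<chi> \<one>" using ideal_zero one_notin_prime[OF p] by auto
    ultimately show "\<chi> \<in> ?Z" using \<chi> by auto
  next
    fix \<chi> assume \<chi>: "\<chi> \<in> ?Z"
    note \<chi>' = \<chi>[unfolded Int_iff INT_iff mem_Collect_eq]
    have \<chi>_add: "\<chi> c" if "a \<in> carrier A" "b \<in> carrier A" "c \<in> a \<oplus> b" "\<chi> a" "\<chi> b" for a b c
      using \<chi>'[THEN conjunct1, THEN conjunct1, THEN conjunct2] that by blast
    have \<chi>_mult: "\<chi> (a \<otimes> b)" if "a \<in> carrier A" "b \<in> carrier A" "\<chi> b" for a b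
      using \<chi>'[THEN conjunct1, THEN conjunct2] that by blast
    have \<chi>_prime: "\<chi> a \<or> \<chi> b" if "a \<in> carrier A" "b \<in> carrier A" "\<chi> (a \<otimes> b)" for a b
      using bspec[OF bspec[OF \<chi>'[THEN conjunct2] that(1)] that(2)] that(3) by blast
    have "c \<in> ?\<psi> \<chi>" if "a \<in> ?\<psi> \<chi>" "b \<in> ?\<psi> \<chi>" "c \<in> a \<oplus> b" for a b c
      using that \<chi>_add[of a b c] add_carrier[of c a b] by simp
    hence "?\<psi> \<chi> \<uplus> ?\<psi> \<chi> \<subseteq> ?\<psi> \<chi>" unfolding set_madd_def by blast
    moreover have "\<zero> \<in> ?\<psi> \<chi>" "\<one> \<notin> ?\<psi> \<chi>" using \<chi>' by (simp_all only: mem_Collect_eq) (simp_all add: zero_closed)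
    moreover have "a \<otimes> b \<in> ?\<psi> \<chi>" if "a \<in> carrier A" "b \<in> ?\<psi> \<chi>" for a b
      using \<chi>_mult that by simp
    moreover have "a \<in> ?\<psi> \<chi> \<or> b \<in> ?\<psi> \<chi>" if "a \<in> carrier A" "b \<in> carrier A" "a \<otimes> b \<in> ?\<psi> \<chi>" for a b
      using \<chi>_prime[of a b] that by simp
    ultimately have "?\<psi> \<chi> \<in> spec A" unfolding spec_def prime_mideal_def mideal_def by blast
    thus "\<chi> \<in> Z" using \<chi>' unfolding Z_def by (simp only: mem_Collect_eq simp_thms)
  qed
  moreover have "closedin ?X ?Z"
    using zero_closed by (intro closedin_Int closedin_INT coord(2) closed_imp)
      (simp_all add: add_nonempty, auto dest: add_carrier)
  ultimately have "closedin ?X Z" by simp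
  moreover have "compact_space ?X"
    by (auto simp: compact_space_product_topology compact_space_discrete_topology)
  ultimately have "compactin ?X Z" by (rule closedin_compact_space[rotated])
  hence "compactin (subtopology ?X Z) Z" by (simp add: compactin_subtopology)
  moreover have "continuous_map (subtopology ?X Z) (constructible_topology A) ?\<psi>"
    unfolding constructible_topology_def
  proof (rule continuous_on_generated_topo)
    fix U assume "U \<in> basic_open A ` carrier A \<union> (\<lambda>a. spec A - basic_open A a) ` carrier A"
    then consider a where "a \<in> carrier A" "U = basic_open A a"
      | a where "a \<in> carrier A" "U = spec A - basic_open A a" by blast
    thus "openin (subtopology ?X Z) (?\<psi> -` U \<inter> topspace (subtopology ?X Z))"
    proof cases
      case 1
      have "?\<psi> -` U \<inter> Z = Z \<inter> {\<chi> \<in> topspace ?X. \<chi> a \<in> {False}}"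
        using Z_mem(1,2) Z_mem(3)[OF _ 1(1)] unfolding 1(2) by blast
      thus ?thesis using ZS[OF 1(1), of "{False}"] by (simp only: Zt)
    next
      case 2
      have "?\<psi> -` U \<inter> Z = Z \<inter> {\<chi> \<in> topspace ?X. \<chi> a \<in> {True}}"
        using Z_mem(1,2) Z_mem(3)[OF _ 2(1)] unfolding 2(2) by blast
      thus ?thesis using ZS[OF 2(1), of "{True}"] by (simp only: Zt)
    qed
  next
    have "?\<psi> ` Z \<subseteq> basic_open A \<one>"
      using Z_mem(2) one_notin_prime unfolding basic_open_def by blast
    thus "?\<psi> ` topspace (subtopology ?X Z) \<subseteq>
        \<Union>(basic_open A ` carrier A \<union> (\<lambda>a. spec A - basic_open A a) ` carrier A)"
      unfolding Zt by blast
  qed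
  ultimately have "compactin (constructible_topology A) (?\<psi> ` Z)" by (rule image_compactin)
  moreover have "?\<psi> ` Z = spec A"
  proof (intro equalityI subsetI)
    fix p assume p: "p \<in> spec A"
    hence "p \<subseteq> carrier A" using mideal_spec unfolding mideal_def by blast
    hence eq: "?\<psi> (\<lambda>a \<in> carrier A. a \<in> p) = p" by auto
    hence "(\<lambda>a \<in> carrier A. a \<in> p) \<in> Z" using p by (simp add: Z_def)
    hence "?\<psi> (\<lambda>a \<in> carrier A. a \<in> p) \<in> ?\<psi> ` Z" by (rule imageI)
    thus "p \<in> ?\<psi> ` Z" unfolding eq .
  next
    fix p assume "p \<in> ?\<psi> ` Z"
    thus "p \<in> spec A" using Z_mem(2) by blast
  qed
  ultimately show ?thesis by (simp add: compact_space_def topspace_spec)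
qed

section \<open>Patching constructible sections\<close>

definition locally_fraction :: "'a set \<Rightarrow> ('a set \<Rightarrow> ('a set \<times> 'a set) set) \<Rightarrow> bool" where
  "locally_fraction p f \<longleftrightarrow> (\<exists>x \<in> carrier A. \<exists>y \<in> carrier A. y \<notin> p \<and>
     eventually (\<lambda>q. f q = residue_fraction A q x y) (near A p))"

lemma section_iff:
  "f \<in> constructible_sections A \<longleftrightarrow>
    f \<in> (\<Pi>\<^sub>E p \<in> spec A. carrier (residue_multifield A p)) \<and> (\<forall>p \<in> spec A. locally_fraction p f)"
proof -
  have "(\<exists>U. \<exists>x \<in> carrier A. \<exists>y \<in> carrier A.
       openin (constructible_topology A) U \<and> closedin (constructible_topology A) U \<and>
       p \<in> U \<and> U \<subseteq> basic_open A y \<and> (\<forall>q \<in> U. f q = residue_fraction A q x y))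
    \<longleftrightarrow> locally_fraction p f" (is "?L \<longleftrightarrow> _") if p: "p \<in> spec A" for p
  proof
    assume ?L
    thus "locally_fraction p f"
      unfolding locally_fraction_def eventually_near_iff[OF p] basic_open_def by blast
  next
    assume "locally_fraction p f"
    then obtain x y where xy: "x \<in> carrier A" "y \<in> carrier A" "y \<notin> p"
      and "eventually (\<lambda>q. f q = residue_fraction A q x y) (near A p)"
      unfolding locally_fraction_def by blast
    from this(4) eventually_near_mem[OF p xy(2)] eventually_near_spec[OF p]
    have "eventually (\<lambda>q. q \<in> basic_open A y \<and> f q = residue_fraction A q x y) (near A p)"
      by eventually_elim (use xy in \<open>auto simp: basic_open_def\<close>)
    thus ?L unfolding eventually_near_iff[OF p] using xy(1,2) by blast
  qed
  thus ?thesis unfolding constructible_sections_def by simp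
qed

text \<open>A property of values that can be satisfied near each point by a fraction can be satisfied
  globally by a section. By compactness finitely many clopen sets \<open>U r\<close> suffice. The section uses at
  \<open>q\<close> the fraction of a chosen \<open>U r\<close> containing \<open>q\<close>; the choice depends only on which of the finitely
  many sets contain \<open>q\<close>, and this is locally constant because they are clopen.\<close>

lemma section_patching:
  assumes "\<And>p. p \<in> spec A \<Longrightarrow> \<exists>k. locally_fraction p k \<and> eventually (\<lambda>q. P q (k q)) (near A p)"
  shows "\<exists>f \<in> constructible_sections A. \<forall>p \<in> spec A. P p (f p)"
proof -
  have "\<exists>U x y. openin (constructible_topology A) U \<and> closedin (constructible_topology A) U \<and> p \<in> U \<and>
      x \<in> carrier A \<and> y \<in> carrier A \<and>
      (\<forall>q \<in> U. q \<in> spec A \<and> y \<notin> q \<and> P q (residue_fraction A q x y))" if p: "p \<in> spec A" for p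
  proof -
    obtain k x y where xy: "x \<in> carrier A" "y \<in> carrier A" "y \<notin> p"
      and k: "eventually (\<lambda>q. k q = residue_fraction A q x y) (near A p)"
        "eventually (\<lambda>q. P q (k q)) (near A p)"
      using assms[OF p] unfolding locally_fraction_def by blast
    from k eventually_near_mem[OF p xy(2)] eventually_near_spec[OF p]
    have "eventually (\<lambda>q. q \<in> spec A \<and> y \<notin> q \<and> P q (residue_fraction A q x y)) (near A p)"
      by eventually_elim (use xy in auto)
    thus ?thesis unfolding eventually_near_iff[OF p] using xy by blast
  qed
  then obtain U x y where U: "\<And>p. p \<in> spec A \<Longrightarrow>
      openin (constructible_topology A) (U p) \<and> closedin (constructible_topology A) (U p) \<and> p \<in> U p \<and>
      x p \<in> carrier A \<and> y p \<in> carrier A \<and>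
      (\<forall>q \<in> U p. q \<in> spec A \<and> y p \<notin> q \<and> P q (residue_fraction A q (x p) (y p)))"
    by metis
  have "compactin (constructible_topology A) (spec A)"
    using compact_spec by (simp add: compact_space_def topspace_spec)
  moreover have "spec A \<subseteq> \<Union>(U ` spec A)" using U by blast
  moreover have "openin (constructible_topology A) V" if "V \<in> U ` spec A" for V using U that by blast
  ultimately have "\<exists>\<F>. finite \<F> \<and> \<F> \<subseteq> U ` spec A \<and> spec A \<subseteq> \<Union>\<F>"
    by (intro compactinD) blast+
  then obtain F where F: "finite F" "F \<subseteq> spec A" "spec A \<subseteq> \<Union>(U ` F)"
    by (metis finite_subset_image)
  \<comment> \<open>As a function of the set \<open>{r \<in> F. q \<in> U r}\<close>, the choice is locally constant in \<open>q\<close>.\<close>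
  define c where "c q = (SOME r. r \<in> {r \<in> F. q \<in> U r})" for q
  have c: "c q \<in> F" "q \<in> U (c q)" if "q \<in> spec A" for q
  proof -
    have "{r \<in> F. q \<in> U r} \<noteq> {}" using F that by blast
    hence "c q \<in> {r \<in> F. q \<in> U r}" unfolding c_def by (rule some_in_eq[THEN iffD2])
    thus "c q \<in> F" "q \<in> U (c q)" by blast+
  qed
  define f where "f = (\<lambda>q \<in> spec A. residue_fraction A q (x (c q)) (y (c q)))"
  have cs: "c q \<in> spec A" if "q \<in> spec A" for q using c(1)[OF that] F by blast
  have P: "P q (f q)" "f q \<in> carrier (residue_multifield A q)" if q: "q \<in> spec A" for q
  proof -
    interpret multiring_prime A q using q by unfold_locales
    show "P q (f q)" "f q \<in> carrier (residue_multifield A q)"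
      using U[OF cs[OF q]] c[OF q] q by (auto simp: f_def intro!: residue_closed)
  qed
  have "locally_fraction p f" if p: "p \<in> spec A" for p
  proof -
    have "\<forall>r \<in> F. eventually (\<lambda>q. q \<in> U r \<longleftrightarrow> p \<in> U r) (near A p)"
      using U F by (auto intro!: eventually_near_clopen[OF p])
    hence "eventually (\<lambda>q. \<forall>r \<in> F. q \<in> U r \<longleftrightarrow> p \<in> U r) (near A p)"
      using F(1) by (simp add: eventually_ball_finite)
    with eventually_near_spec[OF p]
    have "eventually (\<lambda>q. f q = residue_fraction A q (x (c p)) (y (c p))) (near A p)"
    proof eventually_elim
      case (elim q)
      hence "{r \<in> F. q \<in> U r} = {r \<in> F. p \<in> U r}" by blast
      hence "c q = c p" unfolding c_def by simp
      thus ?case using elim by (simp add: f_def)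
    qed
    moreover have "x (c p) \<in> carrier A" "y (c p) \<in> carrier A" "y (c p) \<notin> p"
      using U[OF cs[OF p]] c[OF p] by auto
    ultimately show ?thesis unfolding locally_fraction_def by blast
  qed
  moreover have "f \<in> (\<Pi>\<^sub>E p \<in> spec A. carrier (residue_multifield A p))"
    using P(2) by (auto simp: f_def)
  ultimately have "f \<in> constructible_sections A" unfolding section_iff by blast
  thus ?thesis using P(1) by blast
qed

lemma locally_fraction_extend:
  assumes "p \<in> spec A" "X \<in> carrier (residue_multifield A p)"
  shows "\<exists>k. locally_fraction p k \<and> k p = X"
proof -
  interpret multiring_prime A p using assms by unfold_locales
  obtain x y where "x \<in> carrier A" "y \<in> carrier A" "y \<notin> p" "X = residue_fraction A p x y"
    using assms(2) by (rule residue_cases)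
  moreover from this have "locally_fraction p (\<lambda>q. residue_fraction A q x y)"
    unfolding locally_fraction_def by - (rule bexI[of _ x], rule bexI[of _ y], simp_all)
  ultimately show ?thesis by blast
qed

text \<open>The two elements that witness the relation at \<open>p\<close>, one outside and one inside \<open>p\<close>, witness it
  at every prime ideal near \<open>p\<close>.\<close>

lemma eventually_add:
  assumes p: "p \<in> spec A" and loc: "locally_fraction p f" "locally_fraction p g" "locally_fraction p h"
    and fgh: "f p \<in> g p \<oplus>\<^bsub>residue_multifield A p\<^esub> h p"
  shows "eventually (\<lambda>q. f q \<in> g q \<oplus>\<^bsub>residue_multifield A q\<^esub> h q) (near A p)"
proof -
  interpret multiring_prime A p using p by unfold_locales
  obtain x s where xs: "x \<in> carrier A" "s \<in> carrier A" "s \<notin> p"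
    and f: "eventually (\<lambda>q. f q = residue_fraction A q x s) (near A p)"
    using loc(1) unfolding locally_fraction_def by blast
  obtain y t where yt: "y \<in> carrier A" "t \<in> carrier A" "t \<notin> p"
    and g: "eventually (\<lambda>q. g q = residue_fraction A q y t) (near A p)"
    using loc(2) unfolding locally_fraction_def by blast
  obtain z u where zu: "z \<in> carrier A" "u \<in> carrier A" "u \<notin> p"
    and h: "eventually (\<lambda>q. h q = residue_fraction A q z u) (near A p)"
    using loc(3) unfolding locally_fraction_def by blast
  have "residue_fraction A p x s \<in>
      residue_fraction A p y t \<oplus>\<^bsub>residue_multifield A p\<^esub> residue_fraction A p z u"
    using fgh eventually_near_self[OF p f] eventually_near_self[OF p g] eventually_near_self[OF p h]
    by simp
  then obtain v i where v: "v \<in> carrier A" "v \<notin> p" "i \<in> p"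
    "x \<otimes> t \<otimes> u \<otimes> v \<in> ((y \<otimes> s \<otimes> u \<otimes> v) \<oplus> (z \<otimes> s \<otimes> t \<otimes> v)) \<uplus> {i}"
    using residue_add_iff xs yt zu by auto
  have i: "i \<in> carrier A" using v(3) ideal_subset by blast
  note near = eventually_near_mem[OF p]
  from near[OF xs(2)] near[OF yt(2)] near[OF zu(2)] near[OF v(1)] near[OF i] eventually_near_spec[OF p] f g h
  show ?thesis
  proof eventually_elim
    case (elim q)
    interpret q: multiring_prime A q using elim by unfold_locales
    have "residue_fraction A q x s \<in>
      residue_fraction A q y t \<oplus>\<^bsub>residue_multifield A q\<^esub> residue_fraction A q z u"
      using elim xs yt zu v by (subst q.residue_add_iff) auto
    thus ?case using elim by simp
  qed
qed

end

section \<open>The multiring of constructible sections\<close>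

context multiring
begin

lemma V_simps:
  "carrier (multiring_V A) = constructible_sections A"
  "f \<otimes>\<^bsub>multiring_V A\<^esub> g = (\<lambda>p \<in> spec A. f p \<otimes>\<^bsub>residue_multifield A p\<^esub> g p)"
  "\<one>\<^bsub>multiring_V A\<^esub> = (\<lambda>p \<in> spec A. \<one>\<^bsub>residue_multifield A p\<^esub>)"
  "\<zero>\<^bsub>multiring_V A\<^esub> = (\<lambda>p \<in> spec A. \<zero>\<^bsub>residue_multifield A p\<^esub>)"
  "\<ominus>\<^bsub>multiring_V A\<^esub> f = (\<lambda>p \<in> spec A. \<ominus>\<^bsub>residue_multifield A p\<^esub> f p)"
  "f \<in> g \<oplus>\<^bsub>multiring_V A\<^esub> h \<longleftrightarrow> f \<in> constructible_sections A \<and>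
    (\<forall>p \<in> spec A. f p \<in> g p \<oplus>\<^bsub>residue_multifield A p\<^esub> h p)"
  by (simp_all add: multiring_V_def)

lemma residue_multiring: "p \<in> spec A \<Longrightarrow> multiring (residue_multifield A p)"
  by (rule multiring_prime.multiring_residue) unfold_locales

lemma section_at:
  "f \<in> constructible_sections A \<Longrightarrow> p \<in> spec A \<Longrightarrow> f p \<in> carrier (residue_multifield A p)"
  unfolding section_iff by blast

lemma section_local: "f \<in> constructible_sections A \<Longrightarrow> p \<in> spec A \<Longrightarrow> locally_fraction p f"
  unfolding section_iff by blast

lemma section_eqI:
  assumes "f \<in> constructible_sections A" "g \<in> constructible_sections A" "\<And>p. p \<in> spec A \<Longrightarrow> f p = g p"
  shows "f = g"
  using assms unfolding section_iff by (auto intro: PiE_ext)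

lemma section_const:
  assumes "x \<in> carrier A"
  shows "(\<lambda>p \<in> spec A. residue_fraction A p x \<one>) \<in> constructible_sections A"
proof -
  have "residue_fraction A p x \<one> \<in> carrier (residue_multifield A p)" if p: "p \<in> spec A" for p
  proof -
    interpret multiring_prime A p using p by unfold_locales
    show ?thesis using assms one_notin_prime[OF p] by (intro residue_closed) simp_all
  qed
  moreover have "locally_fraction p (\<lambda>p \<in> spec A. residue_fraction A p x \<one>)" if p: "p \<in> spec A" for p
    unfolding locally_fraction_def
  proof (intro bexI conjI)
    show "eventually (\<lambda>q. (\<lambda>p \<in> spec A. residue_fraction A p x \<one>) q = residue_fraction A q x \<one>) (near A p)"
      using eventually_near_spec[OF p] by eventually_elim simp
  qed (use assms one_notin_prime[OF p] in simp_all)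
  ultimately show ?thesis unfolding section_iff by auto
qed

lemma section_mult:
  assumes f: "f \<in> constructible_sections A" and g: "g \<in> constructible_sections A"
  shows "(\<lambda>p \<in> spec A. f p \<otimes>\<^bsub>residue_multifield A p\<^esub> g p) \<in> constructible_sections A"
proof -
  have "f p \<otimes>\<^bsub>residue_multifield A p\<^esub> g p \<in> carrier (residue_multifield A p)" if p: "p \<in> spec A" for p
  proof -
    interpret K: multiring "residue_multifield A p" using p by (rule residue_multiring)
    show ?thesis using section_at[OF f p] section_at[OF g p] by simp
  qed
  moreover have "locally_fraction p (\<lambda>p \<in> spec A. f p \<otimes>\<^bsub>residue_multifield A p\<^esub> g p)" if p: "p \<in> spec A" for p
  proof -
    obtain x s where xs: "x \<in> carrier A" "s \<in> carrier A" "s \<notin> p"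
      and f': "eventually (\<lambda>q. f q = residue_fraction A q x s) (near A p)"
      using section_local[OF f p] unfolding locally_fraction_def by blast
    obtain y t where yt: "y \<in> carrier A" "t \<in> carrier A" "t \<notin> p"
      and g': "eventually (\<lambda>q. g q = residue_fraction A q y t) (near A p)"
      using section_local[OF g p] unfolding locally_fraction_def by blast
    from f' g' eventually_near_spec[OF p] eventually_near_mem[OF p xs(2)] eventually_near_mem[OF p yt(2)]
    have "eventually (\<lambda>q. (\<lambda>p \<in> spec A. f p \<otimes>\<^bsub>residue_multifield A p\<^esub> g p) q
        = residue_fraction A q (x \<otimes> y) (s \<otimes> t)) (near A p)"
    proof eventually_elim
      case (elim q)
      interpret multiring_prime A q using elim by unfold_locales
      show ?case using elim xs yt by (simp add: residue_mult)
    qed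
    moreover have "x \<otimes> y \<in> carrier A" "s \<otimes> t \<in> carrier A" "s \<otimes> t \<notin> p"
      using xs yt prime_mult[OF p] by simp_all
    ultimately show ?thesis unfolding locally_fraction_def by blast
  qed
  ultimately show ?thesis unfolding section_iff by auto
qed

lemma section_neg:
  assumes f: "f \<in> constructible_sections A"
  shows "(\<lambda>p \<in> spec A. \<ominus>\<^bsub>residue_multifield A p\<^esub> f p) \<in> constructible_sections A"
proof -
  have "\<ominus>\<^bsub>residue_multifield A p\<^esub> f p \<in> carrier (residue_multifield A p)" if p: "p \<in> spec A" for p
    using multiring.neg_closed[OF residue_multiring[OF p] section_at[OF f p]] .
  moreover have "locally_fraction p (\<lambda>p \<in> spec A. \<ominus>\<^bsub>residue_multifield A p\<^esub> f p)" if p: "p \<in> spec A" for p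
  proof -
    obtain x s where xs: "x \<in> carrier A" "s \<in> carrier A" "s \<notin> p"
      and f': "eventually (\<lambda>q. f q = residue_fraction A q x s) (near A p)"
      using section_local[OF f p] unfolding locally_fraction_def by blast
    from f' eventually_near_spec[OF p] eventually_near_mem[OF p xs(2)]
    have "eventually (\<lambda>q. (\<lambda>p \<in> spec A. \<ominus>\<^bsub>residue_multifield A p\<^esub> f p) q
        = residue_fraction A q (\<ominus> x) s) (near A p)"
    proof eventually_elim
      case (elim q)
      interpret multiring_prime A q using elim by unfold_locales
      show ?case using elim xs by (simp add: residue_neg)
    qed
    thus ?thesis unfolding locally_fraction_def using xs neg_closed by blast
  qed
  ultimately show ?thesis unfolding section_iff by auto
qed

lemma V_closed:
  "\<one>\<^bsub>multiring_V A\<^esub> \<in> constructible_sections A"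
  "\<zero>\<^bsub>multiring_V A\<^esub> \<in> constructible_sections A"
  "f \<in> constructible_sections A \<Longrightarrow> \<ominus>\<^bsub>multiring_V A\<^esub> f \<in> constructible_sections A"
  "f \<in> constructible_sections A \<Longrightarrow> g \<in> constructible_sections A \<Longrightarrow>
    f \<otimes>\<^bsub>multiring_V A\<^esub> g \<in> constructible_sections A"
proof -
  have "\<one>\<^bsub>residue_multifield A p\<^esub> = residue_fraction A p \<one> \<one>"
    "\<zero>\<^bsub>residue_multifield A p\<^esub> = residue_fraction A p \<zero> \<one>" if p: "p \<in> spec A" for p
  proof -
    interpret multiring_prime A p using p by unfold_locales
    show "\<one>\<^bsub>residue_multifield A p\<^esub> = residue_fraction A p \<one> \<one>"
      "\<zero>\<^bsub>residue_multifield A p\<^esub> = residue_fraction A p \<zero> \<one>"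
      by (rule residue_one_zero)+
  qed
  hence "\<one>\<^bsub>multiring_V A\<^esub> = (\<lambda>p \<in> spec A. residue_fraction A p \<one> \<one>)"
    "\<zero>\<^bsub>multiring_V A\<^esub> = (\<lambda>p \<in> spec A. residue_fraction A p \<zero> \<one>)"
    unfolding V_simps by (auto intro!: restrict_ext)
  thus "\<one>\<^bsub>multiring_V A\<^esub> \<in> constructible_sections A" "\<zero>\<^bsub>multiring_V A\<^esub> \<in> constructible_sections A"
    by (simp_all add: section_const)
qed (simp_all only: V_simps section_neg section_mult)

text \<open>Every universal axiom holds pointwise. The two existential ones, nonemptiness of sums and
  associativity, have solutions in each \<open>K(p)\<close>; a solution at \<open>p\<close> is a fraction that remains a
  solution near \<open>p\<close>, and patching produces a section.\<close>

theorem multiring_V: "multiring (multiring_V A)"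
  unfolding multiring_def multiring_axioms_def V_simps(1)
proof (intro conjI allI impI)
  note [simp] = section_at V_closed
  note K = residue_multiring
  note mon = multiring.axioms(1)[OF K, THEN comm_monoid.axioms(1)]
  show "comm_monoid (multiring_V A)"
  proof (rule comm_monoidI; (unfold V_simps(1))?)
    fix f g h assume [simp]: "f \<in> constructible_sections A" "g \<in> constructible_sections A" "h \<in> constructible_sections A"
    show "f \<otimes>\<^bsub>multiring_V A\<^esub> g \<otimes>\<^bsub>multiring_V A\<^esub> h = f \<otimes>\<^bsub>multiring_V A\<^esub> (g \<otimes>\<^bsub>multiring_V A\<^esub> h)"
      by (rule section_eqI) (simp_all, simp add: V_simps monoid.m_assoc[OF mon])
  next
    fix f g assume [simp]: "f \<in> constructible_sections A" "g \<in> constructible_sections A"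
    show "f \<otimes>\<^bsub>multiring_V A\<^esub> g = g \<otimes>\<^bsub>multiring_V A\<^esub> f"
      by (rule section_eqI)
        (simp_all, simp add: V_simps comm_monoid.m_comm[OF multiring.axioms(1)[OF K]])
  next
    fix f assume [simp]: "f \<in> constructible_sections A"
    show "\<one>\<^bsub>multiring_V A\<^esub> \<otimes>\<^bsub>multiring_V A\<^esub> f = f"
      by (rule section_eqI) (simp_all, simp add: V_simps monoid.l_one[OF mon])
  qed simp_all
  fix f assume f [simp]: "f \<in> constructible_sections A"
  show "f \<otimes>\<^bsub>multiring_V A\<^esub> \<zero>\<^bsub>multiring_V A\<^esub> = \<zero>\<^bsub>multiring_V A\<^esub>"
    by (rule section_eqI) (simp_all, simp add: V_simps multiring.mult_zero[OF K])
  fix g assume g [simp]: "g \<in> constructible_sections A"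
  show "f \<oplus>\<^bsub>multiring_V A\<^esub> g = g \<oplus>\<^bsub>multiring_V A\<^esub> f"
    by (simp add: set_eq_iff V_simps(6) multiring.add_comm[OF K])
  show "f \<oplus>\<^bsub>multiring_V A\<^esub> g \<noteq> {}"
  proof -
    have "\<exists>k. locally_fraction p k \<and>
        eventually (\<lambda>q. k q \<in> f q \<oplus>\<^bsub>residue_multifield A q\<^esub> g q) (near A p)" if p: "p \<in> spec A" for p
    proof -
      interpret K: multiring "residue_multifield A p" using p by (rule K)
      obtain X where X: "X \<in> f p \<oplus>\<^bsub>residue_multifield A p\<^esub> g p"
        using K.add_nonempty[of "f p" "g p"] p by auto
      have "X \<in> carrier (residue_multifield A p)" using X p by (auto dest: K.add_carrier)
      then obtain k where "locally_fraction p k" "k p = X" using locally_fraction_extend[OF p] by blast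
      thus ?thesis using eventually_add[OF p _ section_local[OF f p] section_local[OF g p]] X by blast
    qed
    from section_patching[OF this] show ?thesis using V_simps(6) by blast
  qed
  show "f \<in> g \<oplus>\<^bsub>multiring_V A\<^esub> \<zero>\<^bsub>multiring_V A\<^esub> \<longleftrightarrow> f = g"
  proof
    assume "f \<in> g \<oplus>\<^bsub>multiring_V A\<^esub> \<zero>\<^bsub>multiring_V A\<^esub>"
    thus "f = g" by (intro section_eqI) (simp_all add: V_simps(4,6) multiring.add_zero[OF K])
  next
    assume "f = g"
    thus "f \<in> g \<oplus>\<^bsub>multiring_V A\<^esub> \<zero>\<^bsub>multiring_V A\<^esub>"
      by (simp add: V_simps(4,6) multiring.add_zero[OF K])
  qed
  fix h assume h [simp]: "h \<in> constructible_sections A"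
  {
    assume add: "f \<in> g \<oplus>\<^bsub>multiring_V A\<^esub> h"
    show "h \<in> (\<ominus>\<^bsub>multiring_V A\<^esub> g) \<oplus>\<^bsub>multiring_V A\<^esub> f" "g \<in> f \<oplus>\<^bsub>multiring_V A\<^esub> (\<ominus>\<^bsub>multiring_V A\<^esub> h)"
      using add multiring.add_reverse[OF K] by (simp_all add: V_simps(5,6))
    fix k assume k [simp]: "k \<in> constructible_sections A"
    show "f \<otimes>\<^bsub>multiring_V A\<^esub> k \<in> (g \<otimes>\<^bsub>multiring_V A\<^esub> k) \<oplus>\<^bsub>multiring_V A\<^esub> (h \<otimes>\<^bsub>multiring_V A\<^esub> k)"
      using add multiring.add_mult[OF K] V_closed(4)[OF f k] by (simp add: V_simps(2,6))
  }
  fix s x assume s: "s \<in> f \<oplus>\<^bsub>multiring_V A\<^esub> g" and x: "x \<in> s \<oplus>\<^bsub>multiring_V A\<^esub> h"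
  have [simp]: "s \<in> constructible_sections A" and xs: "x \<in> constructible_sections A"
    using s x by (simp_all add: V_simps(6))
  have "\<exists>k. locally_fraction p k \<and> eventually (\<lambda>q. k q \<in> g q \<oplus>\<^bsub>residue_multifield A q\<^esub> h q \<and>
      x q \<in> f q \<oplus>\<^bsub>residue_multifield A q\<^esub> k q) (near A p)" if p: "p \<in> spec A" for p
  proof -
    interpret K: multiring "residue_multifield A p" using p by (rule K)
    obtain H where H: "H \<in> g p \<oplus>\<^bsub>residue_multifield A p\<^esub> h p" "x p \<in> f p \<oplus>\<^bsub>residue_multifield A p\<^esub> H"
      using K.add_assoc[of "f p" "g p" "h p" "s p" "x p"] s x p by (auto simp: V_simps(6))
    have "H \<in> carrier (residue_multifield A p)" using H(1) p by (auto dest: K.add_carrier)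
    then obtain k where k: "locally_fraction p k" "k p = H" using locally_fraction_extend[OF p] by blast
    note loc = section_local[OF _ p]
    have "eventually (\<lambda>q. k q \<in> g q \<oplus>\<^bsub>residue_multifield A q\<^esub> h q) (near A p)"
      "eventually (\<lambda>q. x q \<in> f q \<oplus>\<^bsub>residue_multifield A q\<^esub> k q) (near A p)"
      using eventually_add[OF p k(1) loc[OF g] loc[OF h]] eventually_add[OF p loc[OF xs] loc[OF f] k(1)]
        H k(2) by blast+
    thus ?thesis using k(1) eventually_conj by blast
  qed
  from section_patching[OF this]
  show "\<exists>k \<in> g \<oplus>\<^bsub>multiring_V A\<^esub> h. x \<in> f \<oplus>\<^bsub>multiring_V A\<^esub> k"
    using xs V_simps(6) by blast
qed (auto simp: V_simps(6) V_closed)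

end

lemma (in reduced_multiring) reduced_V: "reduced_multiring (multiring_V A)"
proof -
  interpret V: multiring "multiring_V A" by (rule multiring_V)
  note K = reduced_residue
  note [simp] = section_at V_closed
  show ?thesis
  proof (unfold_locales, unfold V_simps(1))
    fix f assume [simp]: "f \<in> constructible_sections A"
    show "f \<otimes>\<^bsub>multiring_V A\<^esub> (f \<otimes>\<^bsub>multiring_V A\<^esub> f) = f"
      by (rule section_eqI) (simp_all, simp add: V_simps reduced_multiring.mult_cube[OF K])
    fix g assume [simp]: "g \<in> constructible_sections A"
    have eq: "f p \<oplus>\<^bsub>residue_multifield A p\<^esub> (g \<otimes>\<^bsub>multiring_V A\<^esub> g \<otimes>\<^bsub>multiring_V A\<^esub> f) p = {f p}"
      if "p \<in> spec A" for p
      using that by (simp add: V_simps(2) reduced_multiring.add_mult_square[OF K])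
    have "h = f" if "h \<in> f \<oplus>\<^bsub>multiring_V A\<^esub> (g \<otimes>\<^bsub>multiring_V A\<^esub> g \<otimes>\<^bsub>multiring_V A\<^esub> f)" for h
      using that eq by (intro section_eqI) (simp_all add: V_simps(6))
    moreover have "f \<in> f \<oplus>\<^bsub>multiring_V A\<^esub> (g \<otimes>\<^bsub>multiring_V A\<^esub> g \<otimes>\<^bsub>multiring_V A\<^esub> f)"
      using eq by (simp add: V_simps(6))
    ultimately show "f \<oplus>\<^bsub>multiring_V A\<^esub> (g \<otimes>\<^bsub>multiring_V A\<^esub> g \<otimes>\<^bsub>multiring_V A\<^esub> f) = {f}" by blast
    fix x y assume "x \<in> (f \<otimes>\<^bsub>multiring_V A\<^esub> f) \<oplus>\<^bsub>multiring_V A\<^esub> (g \<otimes>\<^bsub>multiring_V A\<^esub> g)"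
      "y \<in> (f \<otimes>\<^bsub>multiring_V A\<^esub> f) \<oplus>\<^bsub>multiring_V A\<^esub> (g \<otimes>\<^bsub>multiring_V A\<^esub> g)"
    hence xy: "x \<in> constructible_sections A" "y \<in> constructible_sections A"
      "\<And>p. p \<in> spec A \<Longrightarrow> x p \<in> (f p \<otimes>\<^bsub>residue_multifield A p\<^esub> f p)
        \<oplus>\<^bsub>residue_multifield A p\<^esub> (g p \<otimes>\<^bsub>residue_multifield A p\<^esub> g p)"
      "\<And>p. p \<in> spec A \<Longrightarrow> y p \<in> (f p \<otimes>\<^bsub>residue_multifield A p\<^esub> f p)
        \<oplus>\<^bsub>residue_multifield A p\<^esub> (g p \<otimes>\<^bsub>residue_multifield A p\<^esub> g p)"
      by (simp_all add: V_simps(2,6))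
    show "x = y"
    proof (rule section_eqI[OF xy(1,2)])
      fix p assume p: "p \<in> spec A"
      show "x p = y p"
        using reduced_multiring.add_squares_unique[OF K[OF p] _ _ xy(3)[OF p] xy(4)[OF p]] p by simp
    qed
  qed
qed

text \<open>For reduced multirings semi-reality only means \<open>1 \<noteq> 0\<close>, which holds for sections as soon as
  there is one prime ideal, since \<open>1 \<noteq> 0\<close> in each \<open>K(p)\<close>.\<close>

lemma (in real_reduced_multiring) real_reduced_V: "real_reduced_multiring (multiring_V A)"
proof -
  have red: "reduced_multiring A" "semireal A"
    using real_reduced_iff real_reduced_multiring_axioms by blast+
  interpret reduced_multiring A by (rule red(1))
  interpret V: reduced_multiring "multiring_V A" by (rule reduced_V)
  obtain p where p: "p \<in> spec A" using spec_nonempty red(2) semireal_iff by blast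
  interpret multiring_prime A p using p by unfold_locales
  have "\<one>\<^bsub>multiring_V A\<^esub> p \<noteq> \<zero>\<^bsub>multiring_V A\<^esub> p" using p residue_one_neq_zero by (simp add: V_simps)
  hence "\<one>\<^bsub>multiring_V A\<^esub> \<noteq> \<zero>\<^bsub>multiring_V A\<^esub>" by auto
  thus ?thesis using V.semireal_iff V.reduced_multiring_axioms real_reduced_iff by blast
qed

theorem proposition4p11:
  fixes A :: "('a, 'm) multiring_struct_scheme"
  assumes "multiring A"
  shows "(real_reduced_multiring A \<longrightarrow> real_reduced_multiring (multiring_V A)) \<and>
         (semireal A \<and> von_neumann_hyperring A \<longrightarrow> von_neumann_hyperring (multiring_Q A))"
  using real_reduced_multiring.real_reduced_V von_neumann_hyperring.von_neumann_hyperring_Q by blast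

end
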